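(* Let $S$ be a commutative $k$-algebra, $G$ a finite group, $\alpha_G=(S_g,\alpha_g)_{g\in G}$ a unital partial action of $G$ on $S$ such that $S$ is a partial $\alpha_G$-extension of $S^{\alpha_G}$, and $H$ a normal subgroup of $G$. Then $\alpha_G$ induces a unital partial action $\alpha_{G/H}=(\tilde D_{gH},\alpha_{gH})_{gH\in G/H}$ of the quotient group $G/H$ on $S^{\alpha_H}$ (the one described in the context) such that $S^{\alpha_H}$ is a partial $\alpha_{G/H}$-extension of $S^{\alpha_G}$ and $\big(S^{\alpha_H}\big)^{\alpha_{G/H}}=S^{\alpha_G}$.
   Context: $k$ is a commutative ring with identity; all algebras are associative, unital, commutative $k$-algebras. Partial actions. A partial action of a group $G$ on an algebra $S$ is a family $\alpha_G=(S_g,\alpha_g)_{g\in G}$ such that: each $S_g$ is an ideal of $S$ and $\alpha_g:S_{g^{-1}}\to S_g$ is an algebra isomorphism; $S_1=S$ and $\alpha_1=\mathrm{id}_S$; $\alpha_g(S_{g^{-1}}\cap S_h)=S_g\cap S_{gh}$ for all $g,h$; and $\alpha_g(\alpha_h(x))=\alpha_{gh}(x)$ for all $x\in\alpha_{h^{-1}}(S_h\cap S_{g^{-1}})$ and $g,h\in G$. It is unital if $S_g=S1_g$ with $1_g$ an idempotent of $S$ (possibly $0$) for every $g$; it is global if $S_g=S$ for all $g$. For a subgroup $H$, $\alpha_H=(S_h,\alpha_h)_{h\in H}$. The subalgebra of invariants is $S^{\alpha_G}=\{s\in S:\alpha_g(s1_{g^{-1}})=s1_g\ \forall g\in G\}$.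 Partial Galois extension. For a unital partial action $\alpha_G$ of a finite group $G$ on $S$, $S$ is a partial $\alpha_G$-extension of an algebra $R$ if $R\simeq S^{\alpha_G}$ as $k$-algebras and there are $m\in\mathbb N$ and $x_i,y_i\in S$ ($1\le i\le m$) with $\sum_{i=1}^m x_i\alpha_g(y_i1_{g^{-1}})=\delta_{1,g}$ (equal to $1_S$ if $g=1$ and $0$ otherwise) for each $g\in G$. Globalization. A globalization of $\alpha_G$ is a global action $\beta_G$ of $G$ on an algebra $T$ with an injective (not necessarily identity-preserving) algebra homomorphism $S\to T$, regarded as an inclusion, such that $S$ is an ideal of $T$, $S_g=S\cap\beta_g(S)$, $\beta_g(x)=\alpha_g(x)$ for $x\in S_{g^{-1}}$, and $T=\sum_{g\in G}\beta_g(S)$. Unital partial actions admit a globalization, unique up to isomorphism; $1_S$ is an idempotent of $T$ and $S=T1_S$. The induced partial action. Let $(T,\beta_G)$ be the globalization of $\alpha_G$, $H=\{h_1=1,h_2,\dots,h_m\}$ a normal subgroup of $G$, and put $e_1=1_S$, $e_i=(1_T-1_S)(1_T-\beta_{h_2}(1_S))\cdots(1_T-\beta_{h_{i-1}}(1_S))\beta_{h_i}(1_S)$ for $2\le i\le m$, $\psi_H(t)=\sum_{i=1}^m\beta_{h_i}(t)e_i$ for $t\in T$, and $e_H=\psi_H(1_S)$. Then $\alpha_{G/H}=(\tilde D_{gH},\alpha_{gH})_{gH\in G/H}$ is given by $\tilde 1_{gH}=\beta_g(e_H)1_S$, $\tilde D_{gH}=S^{\alpha_H}\tilde 1_{gH}$,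 and $\alpha_{gH}(x)=\beta_g(\psi_H(x))1_S$ for $x\in\tilde D_{g^{-1}H}$. *)

theory Defs
  imports "HOL-Algebra.Algebra"
begin

text \<open>
  Commutative unital algebras over a commutative ring \<open>k\<close> are structures \<open>S\<close> with
  \<open>algebra k S\<close>. Ideals of an algebra need not contain its unit, so the homomorphisms
  below are not required to preserve \<open>\<one>\<close>.
\<close>

definition nonunital_algebra_hom ::
  "('k, 'x) ring_scheme \<Rightarrow> ('k, 'a, 'y) module_scheme \<Rightarrow> 'a set \<Rightarrow>
   ('k, 'b, 'w) module_scheme \<Rightarrow> 'b set \<Rightarrow> ('a \<Rightarrow> 'b) \<Rightarrow> bool" where
  "nonunital_algebra_hom k A I B J f \<longleftrightarrow>
     f \<in> I \<rightarrow> J \<and>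
     (\<forall>x\<in>I. \<forall>y\<in>I. f (x \<oplus>\<^bsub>A\<^esub> y) = f x \<oplus>\<^bsub>B\<^esub> f y) \<and>
     (\<forall>x\<in>I. \<forall>y\<in>I. f (x \<otimes>\<^bsub>A\<^esub> y) = f x \<otimes>\<^bsub>B\<^esub> f y) \<and>
     (\<forall>c\<in>carrier k. \<forall>x\<in>I. f (c \<odot>\<^bsub>A\<^esub> x) = c \<odot>\<^bsub>B\<^esub> f x)"

definition algebras_isomorphic ::
  "('k, 'x) ring_scheme \<Rightarrow> ('k, 'a, 'y) module_scheme \<Rightarrow> ('k, 'b, 'w) module_scheme \<Rightarrow> bool" where
  "algebras_isomorphic k A B \<longleftrightarrow>
     (\<exists>f. f \<in> ring_iso A B \<and>
          (\<forall>c\<in>carrier k. \<forall>x\<in>carrier A. f (c \<odot>\<^bsub>A\<^esub> x) = c \<odot>\<^bsub>B\<^esub> f x))"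

text \<open>
  In a partial action \<open>(D g, \<alpha> g)\<close> only the restriction of \<open>\<alpha> g\<close> to \<open>D (inv g)\<close> is
  meaningful; its values elsewhere are irrelevant.
\<close>

definition partial_action ::
  "('k, 'x) ring_scheme \<Rightarrow> ('g, 'z) monoid_scheme \<Rightarrow> ('k, 'a, 'y) module_scheme \<Rightarrow>
   ('g \<Rightarrow> 'a set) \<Rightarrow> ('g \<Rightarrow> 'a \<Rightarrow> 'a) \<Rightarrow> bool" where
  "partial_action k G S D \<alpha> \<longleftrightarrow>
     group G \<and> algebra k S \<and>
     (\<forall>g\<in>carrier G. ideal (D g) S) \<and>
     (\<forall>g\<in>carrier G.
        nonunital_algebra_hom k S (D (inv\<^bsub>G\<^esub> g)) S (D g) (\<alpha> g) \<and>
        bij_betw (\<alpha> g) (D (inv\<^bsub>G\<^esub> g)) (D g)) \<and>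
     D \<one>\<^bsub>G\<^esub> = carrier S \<and> (\<forall>x\<in>carrier S. \<alpha> \<one>\<^bsub>G\<^esub> x = x) \<and>
     (\<forall>g\<in>carrier G. \<forall>h\<in>carrier G.
        \<alpha> g ` (D (inv\<^bsub>G\<^esub> g) \<inter> D h) = D g \<inter> D (g \<otimes>\<^bsub>G\<^esub> h)) \<and>
     (\<forall>g\<in>carrier G. \<forall>h\<in>carrier G.
        \<forall>x \<in> \<alpha> (inv\<^bsub>G\<^esub> h) ` (D h \<inter> D (inv\<^bsub>G\<^esub> g)).
          \<alpha> g (\<alpha> h x) = \<alpha> (g \<otimes>\<^bsub>G\<^esub> h) x)"

text \<open>
  The idempotents \<open>u g\<close> (written \<open>1\<^sub>g\<close> on paper) are carried along explicitly; an
  idempotent generator of an ideal of a commutative ring is unique, so they are determined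
  by \<open>D\<close>.
\<close>

definition unital_partial_action ::
  "('k, 'x) ring_scheme \<Rightarrow> ('g, 'z) monoid_scheme \<Rightarrow> ('k, 'a, 'y) module_scheme \<Rightarrow>
   ('g \<Rightarrow> 'a set) \<Rightarrow> ('g \<Rightarrow> 'a \<Rightarrow> 'a) \<Rightarrow> ('g \<Rightarrow> 'a) \<Rightarrow> bool" where
  "unital_partial_action k G S D \<alpha> u \<longleftrightarrow>
     partial_action k G S D \<alpha> \<and>
     (\<forall>g\<in>carrier G. u g \<in> carrier S \<and> u g \<otimes>\<^bsub>S\<^esub> u g = u g \<and> D g = PIdl\<^bsub>S\<^esub> (u g))"

definition global_action ::
  "('k, 'x) ring_scheme \<Rightarrow> ('g, 'z) monoid_scheme \<Rightarrow> ('k, 'a, 'y) module_scheme \<Rightarrow>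
   ('g \<Rightarrow> 'a \<Rightarrow> 'a) \<Rightarrow> bool" where
  "global_action k G T \<beta> \<longleftrightarrow> partial_action k G T (\<lambda>g. carrier T) \<beta>"

definition invariants ::
  "('g, 'z) monoid_scheme \<Rightarrow> ('k, 'a, 'y) module_scheme \<Rightarrow>
   ('g \<Rightarrow> 'a \<Rightarrow> 'a) \<Rightarrow> ('g \<Rightarrow> 'a) \<Rightarrow> 'a set" where
  "invariants G S \<alpha> u =
     {s \<in> carrier S. \<forall>g\<in>carrier G. \<alpha> g (s \<otimes>\<^bsub>S\<^esub> u (inv\<^bsub>G\<^esub> g)) = s \<otimes>\<^bsub>S\<^esub> u g}"

definition invariant_algebra ::
  "('g, 'z) monoid_scheme \<Rightarrow> ('k, 'a, 'y) module_scheme \<Rightarrow>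
   ('g \<Rightarrow> 'a \<Rightarrow> 'a) \<Rightarrow> ('g \<Rightarrow> 'a) \<Rightarrow> ('k, 'a, 'y) module_scheme" where
  "invariant_algebra G S \<alpha> u = S\<lparr>carrier := invariants G S \<alpha> u\<rparr>"

definition partial_galois_extension ::
  "('k, 'x) ring_scheme \<Rightarrow> ('g, 'z) monoid_scheme \<Rightarrow> ('k, 'a, 'y) module_scheme \<Rightarrow>
   ('g \<Rightarrow> 'a set) \<Rightarrow> ('g \<Rightarrow> 'a \<Rightarrow> 'a) \<Rightarrow> ('g \<Rightarrow> 'a) \<Rightarrow>
   ('k, 'b, 'w) module_scheme \<Rightarrow> bool" where
  "partial_galois_extension k G S D \<alpha> u R \<longleftrightarrow>
     finite (carrier G) \<and> unital_partial_action k G S D \<alpha> u \<and> algebra k R \<and>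
     algebras_isomorphic k R (invariant_algebra G S \<alpha> u) \<and>
     (\<exists>(m :: nat) x y.
        (\<forall>i\<in>{1..m}. x i \<in> carrier S \<and> y i \<in> carrier S) \<and>
        (\<forall>g\<in>carrier G.
           (\<Oplus>\<^bsub>S\<^esub>i\<in>{1..m}. x i \<otimes>\<^bsub>S\<^esub> \<alpha> g (y i \<otimes>\<^bsub>S\<^esub> u (inv\<^bsub>G\<^esub> g))) =
           (if g = \<one>\<^bsub>G\<^esub> then \<one>\<^bsub>S\<^esub> else \<zero>\<^bsub>S\<^esub>)))"

text \<open>
  The embedding \<open>\<iota>\<close> of \<open>S\<close> into \<open>T\<close>, on paper regarded as an inclusion, is kept explicit.
  The last clause says \<open>T = \<Sum>\<^sub>g \<beta>\<^sub>g(S)\<close>, with elements of the sum of ideals being finite sums.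
\<close>

definition globalization ::
  "('k, 'x) ring_scheme \<Rightarrow> ('g, 'z) monoid_scheme \<Rightarrow> ('k, 'a, 'y) module_scheme \<Rightarrow>
   ('g \<Rightarrow> 'a set) \<Rightarrow> ('g \<Rightarrow> 'a \<Rightarrow> 'a) \<Rightarrow>
   ('k, 'b, 'w) module_scheme \<Rightarrow> ('g \<Rightarrow> 'b \<Rightarrow> 'b) \<Rightarrow> ('a \<Rightarrow> 'b) \<Rightarrow> bool" where
  "globalization k G S D \<alpha> T \<beta> \<iota> \<longleftrightarrow>
     global_action k G T \<beta> \<and>
     nonunital_algebra_hom k S (carrier S) T (carrier T) \<iota> \<and> inj_on \<iota> (carrier S) \<and>
     ideal (\<iota> ` carrier S) T \<and>
     (\<forall>g\<in>carrier G. \<iota> ` D g = \<iota> ` carrier S \<inter> \<beta> g ` \<iota> ` carrier S) \<and>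
     (\<forall>g\<in>carrier G. \<forall>x\<in>D (inv\<^bsub>G\<^esub> g). \<beta> g (\<iota> x) = \<iota> (\<alpha> g x)) \<and>
     carrier T = {\<Oplus>\<^bsub>T\<^esub>g\<in>F. \<beta> g (\<iota> (s g)) | F s.
                    finite F \<and> F \<subseteq> carrier G \<and> s \<in> F \<rightarrow> carrier S}"

text \<open>
  In the following \<open>h\<close> enumerates \<open>H = {h 1, ..., h m}\<close> with \<open>h 1 = \<one>\<close>. As
  \<open>\<beta> (h 1)\<close> is the identity, the factor for \<open>j = 1\<close> is \<open>1\<^sub>T - 1\<^sub>S\<close>, and
  \<open>ortho_idem S T \<beta> \<iota> h 1 = 1\<^sub>S\<close>.
\<close>

definition ortho_idem ::
  "('k, 'a, 'y) module_scheme \<Rightarrow> ('k, 'b, 'w) module_scheme \<Rightarrow>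
   ('g \<Rightarrow> 'b \<Rightarrow> 'b) \<Rightarrow> ('a \<Rightarrow> 'b) \<Rightarrow> (nat \<Rightarrow> 'g) \<Rightarrow> nat \<Rightarrow> 'b" where
  "ortho_idem S T \<beta> \<iota> h i =
     (\<Otimes>\<^bsub>T\<^esub>j\<in>{1..<i}. \<one>\<^bsub>T\<^esub> \<ominus>\<^bsub>T\<^esub> \<beta> (h j) (\<iota> \<one>\<^bsub>S\<^esub>)) \<otimes>\<^bsub>T\<^esub> \<beta> (h i) (\<iota> \<one>\<^bsub>S\<^esub>)"

definition psi ::
  "('k, 'a, 'y) module_scheme \<Rightarrow> ('k, 'b, 'w) module_scheme \<Rightarrow>
   ('g \<Rightarrow> 'b \<Rightarrow> 'b) \<Rightarrow> ('a \<Rightarrow> 'b) \<Rightarrow> (nat \<Rightarrow> 'g) \<Rightarrow> nat \<Rightarrow> 'b \<Rightarrow> 'b" where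
  "psi S T \<beta> \<iota> h m t = (\<Oplus>\<^bsub>T\<^esub>i\<in>{1..m}. \<beta> (h i) t \<otimes>\<^bsub>T\<^esub> ortho_idem S T \<beta> \<iota> h i)"

text \<open>
  The data of the induced partial action of \<open>G Mod H\<close> at a coset \<open>A\<close>, computed with a chosen
  representative of \<open>A\<close> and pulled back along \<open>\<iota>\<close>. Independence of the representative, and
  membership in the image of \<open>\<iota>\<close>, are claims to be proved, not part of the definitions.
\<close>

definition induced_unit ::
  "('k, 'a, 'y) module_scheme \<Rightarrow> ('k, 'b, 'w) module_scheme \<Rightarrow>
   ('g \<Rightarrow> 'b \<Rightarrow> 'b) \<Rightarrow> ('a \<Rightarrow> 'b) \<Rightarrow> (nat \<Rightarrow> 'g) \<Rightarrow> nat \<Rightarrow> 'g set \<Rightarrow> 'a" where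
  "induced_unit S T \<beta> \<iota> h m A =
     inv_into (carrier S) \<iota>
       (\<beta> (SOME g. g \<in> A) (psi S T \<beta> \<iota> h m \<one>\<^bsub>T\<^esub>) \<otimes>\<^bsub>T\<^esub> \<iota> \<one>\<^bsub>S\<^esub>)"

definition induced_ideal ::
  "('g, 'z) monoid_scheme \<Rightarrow> 'g set \<Rightarrow> ('k, 'a, 'y) module_scheme \<Rightarrow>
   ('g \<Rightarrow> 'a \<Rightarrow> 'a) \<Rightarrow> ('g \<Rightarrow> 'a) \<Rightarrow> ('k, 'b, 'w) module_scheme \<Rightarrow>
   ('g \<Rightarrow> 'b \<Rightarrow> 'b) \<Rightarrow> ('a \<Rightarrow> 'b) \<Rightarrow> (nat \<Rightarrow> 'g) \<Rightarrow> nat \<Rightarrow> 'g set \<Rightarrow> 'a set" where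
  "induced_ideal G H S \<alpha> u T \<beta> \<iota> h m A =
     PIdl\<^bsub>invariant_algebra (G\<lparr>carrier := H\<rparr>) S \<alpha> u\<^esub> (induced_unit S T \<beta> \<iota> h m A)"

definition induced_map ::
  "('k, 'a, 'y) module_scheme \<Rightarrow> ('k, 'b, 'w) module_scheme \<Rightarrow>
   ('g \<Rightarrow> 'b \<Rightarrow> 'b) \<Rightarrow> ('a \<Rightarrow> 'b) \<Rightarrow> (nat \<Rightarrow> 'g) \<Rightarrow> nat \<Rightarrow> 'g set \<Rightarrow> 'a \<Rightarrow> 'a" where
  "induced_map S T \<beta> \<iota> h m A x =
     inv_into (carrier S) \<iota>
       (\<beta> (SOME g. g \<in> A) (psi S T \<beta> \<iota> h m (\<iota> x)) \<otimes>\<^bsub>T\<^esub> \<iota> \<one>\<^bsub>S\<^esub>)"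

end

theory Submission
  imports Defs
begin

text \<open>
  Write \<open>e\<close> for \<open>1\<^sub>S\<close>, seen as an idempotent of the globalization \<open>T\<close>, on which \<open>G\<close> acts by the
  automorphisms \<open>\<beta>\<^sub>g\<close>. The partial action is the restriction of \<open>\<beta>\<close> to the ideal \<open>S = Te\<close>: one has
  \<open>1\<^sub>g = \<beta>\<^sub>g(e)e\<close> and \<open>\<alpha>\<^sub>g(x 1\<^bsub>g\<inverse>\<^esub>) = \<beta>\<^sub>g(x)e\<close>. Conversely, any global action and any idempotent give a
  unital partial action in this way (\<open>is_unital_partial_action\<close>), whose invariants are the
  \<open>s\<close> with \<open>\<beta>\<^sub>g(s)e = s\<beta>\<^sub>g(e)\<close> for all \<open>g\<close>, and whose Galois equations read
  \<open>\<Sum> x\<^sub>i\<beta>\<^sub>g(y\<^sub>i) = \<delta>\<^bsub>1,g\<^esub> e\<close>. The locale \<open>idempotent_restriction\<close> records this picture, and the proof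
  uses it twice.

  The second use is for the quotient group. The fixed ring \<open>T\<^sup>H\<close> carries a global action of \<open>G/H\<close>, and
  \<open>f = \<psi>\<^sub>H(1)\<close> is an idempotent of \<open>T\<^sup>H\<close>, namely the unit of \<open>\<Sum>\<^bsub>h\<in>H\<^esub> \<beta>\<^sub>h(S)\<close>. The map \<open>\<psi>\<^sub>H\<close> is an
  isomorphism of \<open>S\<^bsup>\<alpha>\<^sub>H\<^esup>\<close> onto the ideal \<open>T\<^sup>H f\<close>, with inverse \<open>t \<mapsto> te\<close>; everything about \<open>\<psi>\<^sub>H\<close> follows
  from \<open>\<psi>\<^sub>H(s)\<beta>\<^sub>h(e) = \<beta>\<^sub>h(s)\<close> (\<open>psi_mult_act_H\<close>), since an element of \<open>Tf\<close> is determined by its products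
  with the \<open>\<beta>\<^sub>h(e)\<close> (\<open>eq_on_f_support\<close>). Transporting the restriction of the action of \<open>G/H\<close> to
  \<open>T\<^sup>H f\<close> back along \<open>\<psi>\<^sub>H\<close> gives exactly the formulas that define \<open>\<alpha>\<^bsub>G/H\<^esub>\<close>
  (\<open>quotient_idempotent_restriction\<close>), so it is a unital partial action, and comparing the two
  descriptions of invariants gives \<open>(S\<^bsup>\<alpha>\<^sub>H\<^esup>)\<^bsup>\<alpha>\<^bsub>G/H\<^esub>\<^esup> = S\<^bsup>\<alpha>\<^sub>G\<^esup>\<close>.

  For the Galois condition, let \<open>tr(t) = \<Sum>\<^bsub>h\<in>H\<^esub> \<beta>\<^sub>h(t)\<close>. If \<open>x\<^sub>i, y\<^sub>i\<close> are Galois coordinates of \<open>S\<close> and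
  \<open>c \<in> S\<close> satisfies \<open>tr(c) = f\<close>, then \<open>tr(c x\<^sub>i), tr(y\<^sub>i)\<close> are Galois coordinates for \<open>T\<^sup>H f\<close>. Such a
  \<open>c\<close> exists by Nakayama's lemma: \<open>x\<^sub>j = \<Sum> tr(y\<^sub>i x\<^sub>j) x\<^sub>i\<close> has coefficients in \<open>I = tr(S)\<close>, which is closed
  under the ring operations, so some \<open>r \<in> I\<close> satisfies \<open>r x\<^sub>j = x\<^sub>j\<close> for all \<open>j\<close>; as \<open>e = \<Sum> x\<^sub>i y\<^sub>i\<close>,
  it satisfies \<open>re = e\<close>, and an \<open>H\<close>-fixed element of \<open>Tf\<close> with this property is \<open>f\<close>.
\<close>

section \<open>Subalgebras, finite sums and complements of idempotents\<close>

lemma (in algebra) algebra_restrict_carrier: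
  assumes "subring B M" and "\<And>c x. \<lbrakk>c \<in> carrier R; x \<in> B\<rbrakk> \<Longrightarrow> c \<odot>\<^bsub>M\<^esub> x \<in> B"
  shows "algebra R (M\<lparr>carrier := B\<rparr>)"
proof (rule algebraI)
  have sub: "B \<subseteq> carrier M"
    using subringE(1)[OF assms(1)] .
  show "cring (M\<lparr>carrier := B\<rparr>)"
    using cring.subcringI'[OF M_cring assms(1)] ring.subcring_iff[OF cring.axioms(1)[OF M_cring] sub] by simp
qed (use assms subringE(1)[OF assms(1)] in
    \<open>auto simp: R_cring smult_l_distr smult_r_distr smult_assoc1 smult_assoc2 subset_eq\<close>)

lemma (in ring) finsum_restrict_carrier:
  assumes "subring B R" and "finite I" and "f \<in> I \<rightarrow> B"
  shows "finsum (R\<lparr>carrier := B\<rparr>) f I = finsum R f I"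
  using assms(2,3)
proof (induction I)
  interpret B: ring "R\<lparr>carrier := B\<rparr>"
    using subring_is_ring[OF assms(1)] .
  {
    case empty
    show ?case by simp
  next
    case (insert i I)
    then show ?case
      using subringE(1)[OF assms(1)] by (subst B.finsum_insert, auto simp: Pi_iff subset_eq)
  }
qed

lemma (in abelian_monoid) finsum_finsum_swap:
  assumes "finite I" and "finite J" and "\<And>i j. \<lbrakk>i \<in> I; j \<in> J\<rbrakk> \<Longrightarrow> f i j \<in> carrier G"
  shows "(\<Oplus>i\<in>I. \<Oplus>j\<in>J. f i j) = (\<Oplus>j\<in>J. \<Oplus>i\<in>I. f i j)"
  using assms(1,3)
proof (induction I)
  case empty
  show ?case using assms(2) by simp
next
  case (insert i I)
  have "(\<Oplus>j\<in>J. \<Oplus>i\<in>insert i I. f i j) = (\<Oplus>j\<in>J. f i j \<oplus> (\<Oplus>i\<in>I. f i j))"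
    using insert by (intro finsum_cong') (auto simp: Pi_iff)
  also have "\<dots> = (\<Oplus>j\<in>J. f i j) \<oplus> (\<Oplus>j\<in>J. \<Oplus>i\<in>I. f i j)"
    using insert by (intro finsum_addf) (auto simp: Pi_iff)
  finally show ?case using insert by (simp add: Pi_iff)
qed


lemma (in cring) complement_mult_complement:
  assumes "p \<in> carrier R" and "b \<in> carrier R"
  shows "p \<otimes> b \<oplus> (\<one> \<ominus> p) = \<one> \<ominus> (\<one> \<ominus> b) \<otimes> p"
  using assms by algebra

lemma (in cring) idempotent_absorbs_complement:
  assumes "b \<in> carrier R" and "b \<otimes> b = b" and "q \<in> carrier R"
  shows "b \<otimes> (\<one> \<ominus> (\<one> \<ominus> b) \<otimes> q) = b"
proof -
  have "b \<otimes> (\<one> \<ominus> (\<one> \<ominus> b) \<otimes> q) = b \<ominus> b \<otimes> q \<oplus> b \<otimes> b \<otimes> q"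
    using assms(1,3) by algebra
  also have "\<dots> = b"
    unfolding assms(2) using assms(1,3) by algebra
  finally show ?thesis .
qed


section \<open>Nakayama's lemma for a finite family\<close>

text \<open>
  The elements \<open>\<Sum> a\<^sub>i x\<^sub>i\<close> with coefficients in \<open>I\<close>. The recursion over the list of generators lets the
  proof of Nakayama's lemma eliminate them one at a time.
\<close>

primrec combinations :: "('a, 'b) ring_scheme \<Rightarrow> 'a set \<Rightarrow> 'a list \<Rightarrow> 'a set" where
  "combinations R I [] = {\<zero>\<^bsub>R\<^esub>}"
| "combinations R I (x # xs) = {a \<otimes>\<^bsub>R\<^esub> x \<oplus>\<^bsub>R\<^esub> s | a s. a \<in> I \<and> s \<in> combinations R I xs}"

lemma (in cring) combinations_closed:
  assumes "I \<subseteq> carrier R" and "set xs \<subseteq> carrier R" and "s \<in> combinations R I xs"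
  shows "s \<in> carrier R"
  using assms(2,3) by (induction xs arbitrary: s) (use assms(1) in auto)

lemma (in cring) combinations_add:
  assumes "I \<subseteq> carrier R" and "\<And>a b. \<lbrakk>a \<in> I; b \<in> I\<rbrakk> \<Longrightarrow> a \<oplus> b \<in> I"
    and "set xs \<subseteq> carrier R" and "s \<in> combinations R I xs" and "t \<in> combinations R I xs"
  shows "s \<oplus> t \<in> combinations R I xs"
  using assms(3-5)
proof (induction xs arbitrary: s t)
  case (Cons x xs)
  obtain a s' where s: "s = a \<otimes> x \<oplus> s'" "a \<in> I" "s' \<in> combinations R I xs"
    using Cons.prems by auto
  obtain b t' where t: "t = b \<otimes> x \<oplus> t'" "b \<in> I" "t' \<in> combinations R I xs"
    using Cons.prems by auto
  have cl: "a \<in> carrier R" "b \<in> carrier R" "s' \<in> carrier R" "t' \<in> carrier R" "x \<in> carrier R"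
    using s t assms(1) Cons.prems combinations_closed[of I xs] by auto
  have "s \<oplus> t = (a \<oplus> b) \<otimes> x \<oplus> (s' \<oplus> t')"
    using cl s t by algebra
  moreover have "s' \<oplus> t' \<in> combinations R I xs"
    using Cons s t by auto
  ultimately show ?case
    using s t assms(2) by auto
qed auto

lemma (in cring) combinations_smult:
  assumes "I \<subseteq> carrier R" and "\<And>a. a \<in> I \<Longrightarrow> c \<otimes> a \<in> I" and "c \<in> carrier R"
    and "set xs \<subseteq> carrier R" and "s \<in> combinations R I xs"
  shows "c \<otimes> s \<in> combinations R I xs"
  using assms(4,5)
proof (induction xs arbitrary: s)
  case (Cons x xs)
  obtain a s' where s: "s = a \<otimes> x \<oplus> s'" "a \<in> I" "s' \<in> combinations R I xs"
    using Cons.prems by auto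
  have cl: "a \<in> carrier R" "s' \<in> carrier R" "x \<in> carrier R"
    using s assms(1) Cons.prems combinations_closed[of I xs] by auto
  have "c \<otimes> s = (c \<otimes> a) \<otimes> x \<oplus> c \<otimes> s'"
    using cl s assms(3) by algebra
  moreover have "c \<otimes> s' \<in> combinations R I xs"
    using Cons s by auto
  ultimately show ?case
    using s assms(2) by auto
qed (use assms(3) in auto)

lemma (in cring) combinations_map_mult:
  assumes "I \<subseteq> carrier R" and "c \<in> carrier R"
    and "set xs \<subseteq> carrier R" and "s \<in> combinations R I xs"
  shows "c \<otimes> s \<in> combinations R I (map ((\<otimes>) c) xs)"
  using assms(3,4)
proof (induction xs arbitrary: s)
  case (Cons x xs)
  obtain a s' where s: "s = a \<otimes> x \<oplus> s'" "a \<in> I" "s' \<in> combinations R I xs"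
    using Cons.prems by auto
  have cl: "a \<in> carrier R" "s' \<in> carrier R" "x \<in> carrier R"
    using s assms(1) Cons.prems combinations_closed[of I xs] by auto
  have "c \<otimes> s = a \<otimes> (c \<otimes> x) \<oplus> c \<otimes> s'"
    using cl s assms(2) by algebra
  then show ?case
    using Cons s by auto
qed (use assms(2) in auto)

lemma (in cring) zero_in_combinations:
  assumes "\<zero> \<in> I" and "set xs \<subseteq> carrier R"
  shows "\<zero> \<in> combinations R I xs"
  using assms(2) 
proof (induction xs)
  case (Cons x xs)
  then have "\<zero> = \<zero> \<otimes> x \<oplus> \<zero>" by simp
  moreover have "\<zero> \<in> combinations R I xs" using Cons by simp
  ultimately show ?case using assms(1) unfolding combinations.simps by blast
qed simp

lemma (in cring) mult_member_in_combinations: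
  assumes "\<zero> \<in> I" and "I \<subseteq> carrier R" and "a \<in> I" and "set xs \<subseteq> carrier R" and "x \<in> set xs"
  shows "a \<otimes> x \<in> combinations R I xs"
  using assms(4,5)
proof (induction xs)
  case (Cons y xs)
  show ?case
  proof (cases "x = y")
    case True
    have "a \<otimes> x = a \<otimes> x \<oplus> \<zero>" using assms(2,3) Cons.prems by (auto simp: subset_eq)
    then show ?thesis
      using zero_in_combinations[OF assms(1)] assms(3) Cons.prems True by auto
  next
    case False
    then have "a \<otimes> x \<in> combinations R I xs" using Cons by auto
    moreover have "a \<otimes> x = \<zero> \<otimes> y \<oplus> a \<otimes> x"
      using assms(2,3) Cons.prems False by (auto simp: subset_eq)
    ultimately show ?thesis
      using assms(1) unfolding combinations.simps by blast
  qed
qed simp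

lemma (in cring) combinations_annihilated:
  assumes "I \<subseteq> carrier R" and "c \<in> carrier R" and "set xs \<subseteq> carrier R"
    and "\<And>x. x \<in> set xs \<Longrightarrow> c \<otimes> x = \<zero>" and "s \<in> combinations R I xs"
  shows "c \<otimes> s = \<zero>"
  using assms(3-5)
proof (induction xs arbitrary: s)
  case (Cons x xs)
  obtain a s' where s: "s = a \<otimes> x \<oplus> s'" "a \<in> I" "s' \<in> combinations R I xs"
    using Cons.prems by auto
  have cl: "a \<in> carrier R" "s' \<in> carrier R" "x \<in> carrier R"
    using s assms(1) Cons.prems combinations_closed[of I xs] by auto
  have "c \<otimes> s = a \<otimes> (c \<otimes> x) \<oplus> c \<otimes> s'"
    using cl s assms(2) by algebra
  then show ?case
    using Cons s cl by auto
qed (use assms(2) in auto)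

lemma (in cring) finsum_in_combinations:
  assumes "I \<subseteq> carrier R" and "distinct js" and "\<And>j. j \<in> set js \<Longrightarrow> a j \<in> I \<and> x j \<in> carrier R"
  shows "(\<Oplus>j\<in>set js. a j \<otimes> x j) \<in> combinations R I (map x js)"
  using assms(2,3)
proof (induction js)
  case (Cons j js)
  have "(\<Oplus>j\<in>set (j # js). a j \<otimes> x j) = a j \<otimes> x j \<oplus> (\<Oplus>j\<in>set js. a j \<otimes> x j)"
    using Cons.prems assms(1) by (auto simp: Pi_iff subset_eq)
  then show ?case using Cons by auto
qed simp

text \<open>
  The head of the family is eliminated: \<open>y = a y + s\<close> gives \<open>(1 - a) y = s\<close>, so after multiplication by
  \<open>c = 1 - a\<close> the tail satisfies the hypothesis without \<open>y\<close>. An \<open>r\<close> for the tail then yields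
  \<open>1 - (1 - r) c\<^sup>2\<close> for the whole family. The set \<open>I\<close> is a ring, usually without unit; the case of
  interest is the image of a trace map.
\<close>

lemma (in cring) nakayama:
  assumes I: "I \<subseteq> carrier R" "\<zero> \<in> I" "\<And>a. a \<in> I \<Longrightarrow> \<ominus> a \<in> I"
      "\<And>a b. \<lbrakk>a \<in> I; b \<in> I\<rbrakk> \<Longrightarrow> a \<oplus> b \<in> I" "\<And>a b. \<lbrakk>a \<in> I; b \<in> I\<rbrakk> \<Longrightarrow> a \<otimes> b \<in> I"
    and "set xs \<subseteq> carrier R" and "\<And>x. x \<in> set xs \<Longrightarrow> x \<in> combinations R I xs"
  shows "\<exists>r\<in>I. \<forall>x\<in>set xs. r \<otimes> x = x"
  using assms(6,7)
proof (induction "length xs" arbitrary: xs)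
  case 0
  then show ?case using I(2) by auto
next
  case (Suc n)
  then obtain y ys where xs: "xs = y # ys" and n: "n = length ys"
    by (cases xs) auto
  have ys: "y \<in> carrier R" "set ys \<subseteq> carrier R"
    using Suc.prems xs by auto
  obtain a s where y: "y = a \<otimes> y \<oplus> s" "a \<in> I" "s \<in> combinations R I ys"
    using Suc.prems(2)[of y] xs by auto
  have a: "a \<in> carrier R" and s: "s \<in> carrier R"
    using y I(1) combinations_closed[OF I(1) ys(2)] by auto
  define c where "c = \<one> \<ominus> a"
  have c: "c \<in> carrier R" using a by (simp add: c_def)
  have cI: "c \<otimes> b \<in> I" if "b \<in> I" for b
  proof -
    have "b \<in> carrier R" using that I(1) by auto
    then have "c \<otimes> b = b \<oplus> \<ominus> (a \<otimes> b)"
      using a unfolding c_def by algebra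
    then show ?thesis using that y(2) I by simp
  qed
  have cy: "c \<otimes> y = s"
  proof -
    have "c \<otimes> y = y \<ominus> a \<otimes> y"
      unfolding c_def using a ys(1) by algebra
    also have "\<dots> = (a \<otimes> y \<oplus> s) \<ominus> a \<otimes> y" using y(1) by simp
    also have "\<dots> = s" using a ys(1) s by algebra
    finally show ?thesis .
  qed
  let ?ys = "map ((\<otimes>) c) ys"
  have ys': "set ?ys \<subseteq> carrier R" using ys c by auto
  have "x' \<in> combinations R I ?ys" if x': "x' \<in> set ?ys" for x'
  proof -
    obtain x where x: "x \<in> set ys" "x' = c \<otimes> x" using x' by auto
    then obtain b s' where bs: "x = b \<otimes> y \<oplus> s'" "b \<in> I" "s' \<in> combinations R I ys"
      using Suc.prems(2)[of x] xs by auto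
    have cl: "b \<in> carrier R" "s' \<in> carrier R" "x \<in> carrier R" "x' \<in> carrier R"
      using bs I(1) combinations_closed[OF I(1) ys(2)] x ys c by auto
    \<comment> \<open>multiplying by \<open>c\<close> once more turns \<open>c y\<close> into \<open>s\<close>, a combination of the tail\<close>
    have "c \<otimes> x = b \<otimes> (c \<otimes> y) \<oplus> c \<otimes> s'"
      using bs(1) cl c ys(1) by algebra
    then have "c \<otimes> x' = c \<otimes> (b \<otimes> s \<oplus> c \<otimes> s')"
      using x cy by simp
    also have "\<dots> = b \<otimes> (c \<otimes> s) \<oplus> c \<otimes> (c \<otimes> s')"
      using cl c s by algebra
    finally have cx': "c \<otimes> x' = b \<otimes> (c \<otimes> s) \<oplus> c \<otimes> (c \<otimes> s')" .
    have "x' = a \<otimes> x' \<oplus> c \<otimes> x'"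
      unfolding c_def using cl a by algebra
    also have "\<dots> \<in> combinations R I ?ys"
    proof -
      have "b \<otimes> (c \<otimes> s) \<in> combinations R I ?ys"
        using combinations_smult[OF I(1) _ cl(1) ys'] I(5)[OF bs(2)]
          combinations_map_mult[OF I(1) c ys(2) y(3)] by blast
      moreover have "c \<otimes> (c \<otimes> s') \<in> combinations R I ?ys"
        using combinations_smult[OF I(1) cI c ys'] combinations_map_mult[OF I(1) c ys(2) bs(3)]
        by blast
      ultimately show ?thesis
        unfolding cx' using mult_member_in_combinations[OF I(2,1) y(2) ys' x']
          combinations_add[OF I(1,4) ys'] by simp
    qed
    finally show ?thesis .
  qed
  then obtain r where r: "r \<in> I" "\<forall>x\<in>set ?ys. r \<otimes> x = x"
    using Suc.hyps(1)[of ?ys] n ys' by auto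
  have rc: "r \<in> carrier R" using r I(1) by auto
  \<comment> \<open>\<open>(1 - r) (1 - a)\<close> kills \<open>ys\<close>, hence also \<open>(1 - a) y\<close>\<close>
  have kill: "(\<one> \<ominus> r) \<otimes> c \<otimes> x = \<zero>" if "x \<in> set ys" for x
  proof -
    have x: "x \<in> carrier R" "r \<otimes> (c \<otimes> x) = c \<otimes> x" using that ys r by auto
    have "(\<one> \<ominus> r) \<otimes> c \<otimes> x = c \<otimes> x \<ominus> r \<otimes> (c \<otimes> x)"
      using x(1) c rc by algebra
    also have "\<dots> = \<zero>" using x c by (simp add: r_right_minus_eq)
    finally show ?thesis .
  qed
  have kill_s: "(\<one> \<ominus> r) \<otimes> c \<otimes> s = \<zero>"
    using combinations_annihilated[OF I(1) _ ys(2) kill y(3)] c rc by simp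
  \<comment> \<open>\<open>q = 1 - (1 - r) c\<^sup>2\<close>, written without \<open>1\<close> to make membership in \<open>I\<close> visible\<close>
  define q where "q = r \<oplus> c \<otimes> a \<oplus> a \<oplus> \<ominus> (r \<otimes> (a \<oplus> c \<otimes> a))"
  have qI: "q \<in> I"
    unfolding q_def using r y cI I by simp
  have qc: "q \<in> carrier R" using qI I(1) by auto
  have q: "q \<otimes> x = x \<ominus> c \<otimes> ((\<one> \<ominus> r) \<otimes> c \<otimes> x)" if "x \<in> carrier R" for x
    unfolding q_def c_def using that rc a by algebra
  have "q \<otimes> x = x" if "x \<in> set xs" for x
  proof -
    have x: "x \<in> carrier R" using that Suc.prems by auto
    have "c \<otimes> ((\<one> \<ominus> r) \<otimes> c \<otimes> x) = \<zero>"
    proof (cases "x = y")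
      case True
      have "c \<otimes> ((\<one> \<ominus> r) \<otimes> c \<otimes> y) = c \<otimes> ((\<one> \<ominus> r) \<otimes> (c \<otimes> y))"
        using c rc ys(1) by algebra
      also have "\<dots> = (\<one> \<ominus> r) \<otimes> c \<otimes> s"
        unfolding cy using c rc s by algebra
      finally show ?thesis using kill_s True by simp
    next
      case False
      then show ?thesis using kill that xs c by auto
    qed
    then show ?thesis using q[OF x] x by (simp add: minus_eq)
  qed
  then show ?case using qI by auto
qed


section \<open>Global actions and their restrictions to idempotent ideals\<close>

locale algebra_action = group G + T: algebra k T
  for k :: "('k, 'x) ring_scheme" and G :: "('g, 'z) monoid_scheme" (structure)
    and T :: "('k, 'b, 'w) module_scheme" +
  fixes \<beta> :: "'g \<Rightarrow> 'b \<Rightarrow> 'b"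
  assumes act_closed [simp, intro]:
      "\<lbrakk>g \<in> carrier G; t \<in> carrier T\<rbrakk> \<Longrightarrow> \<beta> g t \<in> carrier T"
    and act_add: "\<lbrakk>g \<in> carrier G; s \<in> carrier T; t \<in> carrier T\<rbrakk> \<Longrightarrow>
      \<beta> g (s \<oplus>\<^bsub>T\<^esub> t) = \<beta> g s \<oplus>\<^bsub>T\<^esub> \<beta> g t"
    and act_mult: "\<lbrakk>g \<in> carrier G; s \<in> carrier T; t \<in> carrier T\<rbrakk> \<Longrightarrow>
      \<beta> g (s \<otimes>\<^bsub>T\<^esub> t) = \<beta> g s \<otimes>\<^bsub>T\<^esub> \<beta> g t"
    and act_smult: "\<lbrakk>g \<in> carrier G; c \<in> carrier k; t \<in> carrier T\<rbrakk> \<Longrightarrow>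
      \<beta> g (c \<odot>\<^bsub>T\<^esub> t) = c \<odot>\<^bsub>T\<^esub> \<beta> g t"
    and act_id [simp]: "t \<in> carrier T \<Longrightarrow> \<beta> \<one> t = t"
    and act_act: "\<lbrakk>g \<in> carrier G; h \<in> carrier G; t \<in> carrier T\<rbrakk> \<Longrightarrow>
      \<beta> g (\<beta> h t) = \<beta> (g \<otimes> h) t"

text \<open>
  The composition law of a partial action speaks of the elements of \<open>\<beta>\<^bsub>h\<inverse>\<^esub>(T)\<close>, which are all elements
  of \<open>T\<close>.
\<close>

lemma algebra_actionI_global_action:
  assumes "global_action k G T \<beta>"
  shows "algebra_action k G T \<beta>"
proof -
  have *: "partial_action k G T (\<lambda>g. carrier T) \<beta>"
    using assms by (simp add: global_action_def)
  then interpret group G + T: algebra k T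
    by (simp_all add: partial_action_def)
  have hom: "nonunital_algebra_hom k T (carrier T) T (carrier T) (\<beta> g)"
    if "g \<in> carrier G" for g
    using * that by (simp add: partial_action_def)
  then have cl: "\<beta> g t \<in> carrier T" if "g \<in> carrier G" "t \<in> carrier T" for g t
    using that by (auto simp: nonunital_algebra_hom_def Pi_iff)
  have img: "\<beta> g ` carrier T = carrier T" if "g \<in> carrier G" for g
    using * that by (auto simp: partial_action_def bij_betw_def)
  show ?thesis
  proof unfold_locales
    fix g h t
    assume "g \<in> carrier G" "h \<in> carrier G" "t \<in> carrier T"
    moreover then have "t \<in> \<beta> (inv\<^bsub>G\<^esub> h) ` (carrier T \<inter> carrier T)"
      using img by simp
    ultimately show "\<beta> g (\<beta> h t) = \<beta> (g \<otimes>\<^bsub>G\<^esub> h) t"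
      using * unfolding partial_action_def by blast
  qed (use hom cl * in \<open>auto simp: nonunital_algebra_hom_def partial_action_def\<close>)
qed

context algebra_action
begin

lemma act_inv [simp]: "\<lbrakk>g \<in> carrier G; t \<in> carrier T\<rbrakk> \<Longrightarrow> \<beta> (inv g) (\<beta> g t) = t"
  by (simp add: act_act)

lemma act_inv' [simp]: "\<lbrakk>g \<in> carrier G; t \<in> carrier T\<rbrakk> \<Longrightarrow> \<beta> g (\<beta> (inv g) t) = t"
  by (simp add: act_act)

text \<open>
  The maps \<open>\<beta>\<^sub>g\<close> are only assumed multiplicative; they preserve the unit because they are onto.
\<close>

lemma act_one [simp]:
  assumes "g \<in> carrier G"
  shows "\<beta> g \<one>\<^bsub>T\<^esub> = \<one>\<^bsub>T\<^esub>"
proof -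
  have "\<one>\<^bsub>T\<^esub> = \<beta> g (\<one>\<^bsub>T\<^esub> \<otimes>\<^bsub>T\<^esub> \<beta> (inv g) \<one>\<^bsub>T\<^esub>)"
    using assms by simp
  also have "\<dots> = \<beta> g \<one>\<^bsub>T\<^esub> \<otimes>\<^bsub>T\<^esub> \<beta> g (\<beta> (inv g) \<one>\<^bsub>T\<^esub>)"
    using assms by (intro act_mult) auto
  also have "\<dots> = \<beta> g \<one>\<^bsub>T\<^esub>"
    using assms by simp
  finally show ?thesis by simp
qed

lemma act_zero [simp]:
  assumes "g \<in> carrier G"
  shows "\<beta> g \<zero>\<^bsub>T\<^esub> = \<zero>\<^bsub>T\<^esub>"
proof -
  have "\<beta> g \<zero>\<^bsub>T\<^esub> \<oplus>\<^bsub>T\<^esub> \<beta> g \<zero>\<^bsub>T\<^esub> = \<beta> g \<zero>\<^bsub>T\<^esub>"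
    using act_add[of g "\<zero>\<^bsub>T\<^esub>" "\<zero>\<^bsub>T\<^esub>"] assms by simp
  then show ?thesis using assms by (simp add: T.M.add.r_cancel_one)
qed

lemma act_a_inv:
  assumes "g \<in> carrier G" and "t \<in> carrier T"
  shows "\<beta> g (\<ominus>\<^bsub>T\<^esub> t) = \<ominus>\<^bsub>T\<^esub> \<beta> g t"
proof -
  have "\<beta> g (\<ominus>\<^bsub>T\<^esub> t) \<oplus>\<^bsub>T\<^esub> \<beta> g t = \<zero>\<^bsub>T\<^esub>"
    using act_add[of g "\<ominus>\<^bsub>T\<^esub> t" t] assms by (simp add: T.M.l_neg)
  then show ?thesis using assms by (simp add: T.M.minus_equality)
qed

lemma act_finsum:
  assumes "g \<in> carrier G" and "finite I" and "f \<in> I \<rightarrow> carrier T"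
  shows "\<beta> g (\<Oplus>\<^bsub>T\<^esub>i\<in>I. f i) = (\<Oplus>\<^bsub>T\<^esub>i\<in>I. \<beta> g (f i))"
  using assms(2,3) by (induction I) (use assms(1) in \<open>auto simp: act_add Pi_iff\<close>)

end

text \<open>
  The algebra \<open>S\<close> is embedded by \<open>\<iota>\<close> as the ideal \<open>Te\<close> generated by the idempotent \<open>e = \<iota> 1\<^sub>S\<close>, and \<open>\<alpha>\<close>
  is obtained from the global action by cutting off with \<open>e\<close>. The factor \<open>e\<close> in the formula for
  \<open>\<alpha>\<close> disappears on the domain (\<open>emb_map_domain\<close>); it is kept because the induced maps
  are given in that form. Besides \<open>S\<close> in \<open>T\<close>, the locale is meant for \<open>T\<^sup>H f\<close> in \<open>T\<^sup>H\<close> with \<open>G/H\<close> acting.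
\<close>

locale idempotent_restriction = algebra_action k G T \<beta> + S: algebra k S
  for k :: "('k, 'x) ring_scheme" and G :: "('g, 'z) monoid_scheme" (structure)
    and T :: "('k, 'b, 'w) module_scheme" and \<beta> :: "'g \<Rightarrow> 'b \<Rightarrow> 'b"
    and S :: "('k, 'a, 'y) module_scheme" +
  fixes D :: "'g \<Rightarrow> 'a set" and \<alpha> :: "'g \<Rightarrow> 'a \<Rightarrow> 'a" and u :: "'g \<Rightarrow> 'a" and \<iota> :: "'a \<Rightarrow> 'b"
  assumes emb_hom: "nonunital_algebra_hom k S (carrier S) T (carrier T) \<iota>"
    and emb_inj: "inj_on \<iota> (carrier S)"
    and emb_image: "\<iota> ` carrier S = {t \<in> carrier T. t \<otimes>\<^bsub>T\<^esub> \<iota> \<one>\<^bsub>S\<^esub> = t}"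
    and unit_closed: "g \<in> carrier G \<Longrightarrow> u g \<in> carrier S"
    and emb_unit: "g \<in> carrier G \<Longrightarrow> \<iota> (u g) = \<beta> g (\<iota> \<one>\<^bsub>S\<^esub>) \<otimes>\<^bsub>T\<^esub> \<iota> \<one>\<^bsub>S\<^esub>"
    and domain_eq: "g \<in> carrier G \<Longrightarrow> D g = PIdl\<^bsub>S\<^esub> (u g)"
    and map_closed: "\<lbrakk>g \<in> carrier G; x \<in> D (inv g)\<rbrakk> \<Longrightarrow> \<alpha> g x \<in> carrier S"
    and emb_map: "\<lbrakk>g \<in> carrier G; x \<in> D (inv g)\<rbrakk> \<Longrightarrow>
      \<iota> (\<alpha> g x) = \<beta> g (\<iota> x) \<otimes>\<^bsub>T\<^esub> \<iota> \<one>\<^bsub>S\<^esub>"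
begin

abbreviation e where "e \<equiv> \<iota> \<one>\<^bsub>S\<^esub>"

lemma emb_closed [simp, intro]: "x \<in> carrier S \<Longrightarrow> \<iota> x \<in> carrier T"
  and emb_add: "\<lbrakk>x \<in> carrier S; y \<in> carrier S\<rbrakk> \<Longrightarrow> \<iota> (x \<oplus>\<^bsub>S\<^esub> y) = \<iota> x \<oplus>\<^bsub>T\<^esub> \<iota> y"
  and emb_mult: "\<lbrakk>x \<in> carrier S; y \<in> carrier S\<rbrakk> \<Longrightarrow> \<iota> (x \<otimes>\<^bsub>S\<^esub> y) = \<iota> x \<otimes>\<^bsub>T\<^esub> \<iota> y"
  and emb_smult: "\<lbrakk>c \<in> carrier k; x \<in> carrier S\<rbrakk> \<Longrightarrow> \<iota> (c \<odot>\<^bsub>S\<^esub> x) = c \<odot>\<^bsub>T\<^esub> \<iota> x"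
  using emb_hom by (auto simp: nonunital_algebra_hom_def)

lemma emb_eq_iff: "\<lbrakk>x \<in> carrier S; y \<in> carrier S\<rbrakk> \<Longrightarrow> \<iota> x = \<iota> y \<longleftrightarrow> x = y"
  using emb_inj by (auto dest: inj_onD)

lemma emb_e [simp]: "x \<in> carrier S \<Longrightarrow> \<iota> x \<otimes>\<^bsub>T\<^esub> e = \<iota> x"
  using emb_image by auto

lemma emb_e_left [simp]: "x \<in> carrier S \<Longrightarrow> e \<otimes>\<^bsub>T\<^esub> \<iota> x = \<iota> x"
  using emb_e T.m_comm[of e "\<iota> x"] by simp

lemma emb_mult_e [simp]:
  "\<lbrakk>x \<in> carrier S; t \<in> carrier T\<rbrakk> \<Longrightarrow> \<iota> x \<otimes>\<^bsub>T\<^esub> (e \<otimes>\<^bsub>T\<^esub> t) = \<iota> x \<otimes>\<^bsub>T\<^esub> t"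
  by (simp flip: T.m_assoc)

lemma act_e_absorb: "\<lbrakk>g \<in> carrier G; x \<in> carrier S\<rbrakk> \<Longrightarrow> \<beta> g (\<iota> x) \<otimes>\<^bsub>T\<^esub> \<beta> g e = \<beta> g (\<iota> x)"
  by (simp flip: act_mult)

lemma preimage:
  assumes "t \<in> carrier T" and "t \<otimes>\<^bsub>T\<^esub> e = t"
  obtains x where "x \<in> carrier S" and "\<iota> x = t"
proof -
  have "t \<in> \<iota> ` carrier S"
    unfolding emb_image using assms by simp
  then show ?thesis using that by auto
qed

lemma emb_zero [simp]: "\<iota> \<zero>\<^bsub>S\<^esub> = \<zero>\<^bsub>T\<^esub>"
proof -
  have "\<iota> \<zero>\<^bsub>S\<^esub> \<oplus>\<^bsub>T\<^esub> \<iota> \<zero>\<^bsub>S\<^esub> = \<iota> \<zero>\<^bsub>S\<^esub>"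
    using emb_add[of "\<zero>\<^bsub>S\<^esub>" "\<zero>\<^bsub>S\<^esub>"] by simp
  then show ?thesis by (simp add: T.M.add.r_cancel_one)
qed

lemma emb_a_inv:
  assumes "x \<in> carrier S"
  shows "\<iota> (\<ominus>\<^bsub>S\<^esub> x) = \<ominus>\<^bsub>T\<^esub> \<iota> x"
proof -
  have "\<iota> (\<ominus>\<^bsub>S\<^esub> x) \<oplus>\<^bsub>T\<^esub> \<iota> x = \<zero>\<^bsub>T\<^esub>"
    using emb_add[of "\<ominus>\<^bsub>S\<^esub> x" x] assms by (simp add: S.M.l_neg)
  then show ?thesis using assms by (simp add: T.M.minus_equality)
qed

lemma emb_finsum:
  assumes "finite I" and "f \<in> I \<rightarrow> carrier S"
  shows "\<iota> (\<Oplus>\<^bsub>S\<^esub>i\<in>I. f i) = (\<Oplus>\<^bsub>T\<^esub>i\<in>I. \<iota> (f i))"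
  using assms by (induction I) (auto simp: emb_add Pi_iff)

text \<open>
  The domain \<open>S 1\<^sub>g\<close> is \<open>Te \<inter> T\<beta>\<^sub>g(e)\<close>. All axioms of a partial action reduce to equations in \<open>T\<close>
  by this criterion.
\<close>

lemma in_domain_iff:
  assumes g: "g \<in> carrier G"
  shows "x \<in> D g \<longleftrightarrow> x \<in> carrier S \<and> \<iota> x \<otimes>\<^bsub>T\<^esub> \<beta> g e = \<iota> x"
proof
  assume "x \<in> D g"
  then obtain y where y: "y \<in> carrier S" "x = y \<otimes>\<^bsub>S\<^esub> u g"
    using domain_eq[OF g] by (auto simp: cgenideal_def)
  have "\<iota> x = \<iota> y \<otimes>\<^bsub>T\<^esub> \<beta> g e"
    using y g unit_closed[OF g] by (simp add: emb_mult emb_unit T.m_comm T.m_lcomm)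
  moreover have "\<beta> g e \<otimes>\<^bsub>T\<^esub> \<beta> g e = \<beta> g e"
    using act_e_absorb g by simp
  ultimately show "x \<in> carrier S \<and> \<iota> x \<otimes>\<^bsub>T\<^esub> \<beta> g e = \<iota> x"
    using y g unit_closed[OF g] by (simp add: T.m_assoc)
next
  assume x: "x \<in> carrier S \<and> \<iota> x \<otimes>\<^bsub>T\<^esub> \<beta> g e = \<iota> x"
  then have "\<iota> (x \<otimes>\<^bsub>S\<^esub> u g) = \<iota> x"
    using g unit_closed[OF g] by (simp add: emb_mult emb_unit flip: T.m_assoc)
  then have "x = x \<otimes>\<^bsub>S\<^esub> u g"
    using x unit_closed[OF g] emb_eq_iff[of "x \<otimes>\<^bsub>S\<^esub> u g" x] by simp
  then show "x \<in> D g"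
    using x domain_eq[OF g] by (auto simp: cgenideal_def)
qed

lemma domain_subset: "g \<in> carrier G \<Longrightarrow> D g \<subseteq> carrier S"
  by (auto simp: in_domain_iff)

lemma emb_map_domain:
  assumes "g \<in> carrier G" and "x \<in> D (inv g)"
  shows "\<iota> (\<alpha> g x) = \<beta> g (\<iota> x)"
proof -
  have x: "x \<in> carrier S" "\<iota> x \<otimes>\<^bsub>T\<^esub> \<beta> (inv g) e = \<iota> x"
    using assms by (auto simp: in_domain_iff)
  have "\<beta> g (\<iota> x \<otimes>\<^bsub>T\<^esub> \<beta> (inv g) e) = \<beta> g (\<iota> x) \<otimes>\<^bsub>T\<^esub> e"
    using assms(1) x(1) by (simp add: act_mult)
  then show ?thesis using emb_map[OF assms] x(2) by simp
qed

lemma map_in_domain: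
  assumes "g \<in> carrier G" and "x \<in> D (inv g)"
  shows "\<alpha> g x \<in> D g"
  using assms map_closed[OF assms] act_e_absorb[of g x]
  by (simp add: in_domain_iff emb_map_domain)

lemma map_inverse:
  assumes g: "g \<in> carrier G" and "x \<in> D g"
  shows "\<alpha> (inv g) x \<in> D (inv g)" and "\<alpha> g (\<alpha> (inv g) x) = x"
proof -
  show *: "\<alpha> (inv g) x \<in> D (inv g)"
    using map_in_domain[of "inv g" x] assms by simp
  have "\<iota> (\<alpha> g (\<alpha> (inv g) x)) = \<iota> x"
    using emb_map_domain[OF g *] emb_map_domain[of "inv g" x] assms domain_subset[OF g] by auto
  then show "\<alpha> g (\<alpha> (inv g) x) = x"
    using emb_eq_iff map_closed[OF g *] assms domain_subset[OF g] by auto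
qed

lemma map_image_domains:
  assumes g: "g \<in> carrier G" and h: "h \<in> carrier G"
  shows "\<alpha> g ` (D (inv g) \<inter> D h) = D g \<inter> D (g \<otimes> h)"
proof (intro equalityI subsetI)
  fix y
  assume "y \<in> \<alpha> g ` (D (inv g) \<inter> D h)"
  then obtain x where x: "x \<in> D (inv g)" "x \<in> D h" "y = \<alpha> g x" by auto
  have xS: "x \<in> carrier S" "\<iota> x \<otimes>\<^bsub>T\<^esub> \<beta> h e = \<iota> x"
    using x(2) h by (auto simp: in_domain_iff)
  have "\<beta> g (\<iota> x \<otimes>\<^bsub>T\<^esub> \<beta> h e) = \<beta> g (\<iota> x) \<otimes>\<^bsub>T\<^esub> \<beta> (g \<otimes> h) e"
    using g h xS(1) by (simp add: act_mult act_act)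
  then have "\<alpha> g x \<in> D (g \<otimes> h)"
    using g h map_closed[OF g x(1)] by (simp add: in_domain_iff emb_map_domain[OF g x(1)] xS(2))
  then show "y \<in> D g \<inter> D (g \<otimes> h)"
    using x(3) map_in_domain[OF g x(1)] by simp
next
  fix y
  assume y: "y \<in> D g \<inter> D (g \<otimes> h)"
  then have yS: "y \<in> carrier S" "\<iota> y \<otimes>\<^bsub>T\<^esub> \<beta> (g \<otimes> h) e = \<iota> y"
    using g h by (auto simp: in_domain_iff)
  have y': "\<alpha> (inv g) y \<in> D (inv g)"
    using map_inverse(1)[OF g] y by simp
  have "inv g \<otimes> (g \<otimes> h) = h"
    using g h by (simp flip: m_assoc)
  then have "\<beta> (inv g) (\<iota> y \<otimes>\<^bsub>T\<^esub> \<beta> (g \<otimes> h) e) = \<beta> (inv g) (\<iota> y) \<otimes>\<^bsub>T\<^esub> \<beta> h e"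
    using g h yS(1) by (simp add: act_mult act_act)
  then have "\<alpha> (inv g) y \<in> D h"
    using emb_map_domain[of "inv g" y] map_closed[of "inv g" y] y g h
    by (simp add: in_domain_iff[OF h] yS(2))
  then show "y \<in> \<alpha> g ` (D (inv g) \<inter> D h)"
    using map_inverse(2)[OF g, of y] y y' by (metis IntD1 IntI imageI)
qed

text \<open>
  Each axiom is checked in \<open>T\<close>, where \<open>\<alpha>\<^sub>g\<close> is \<open>\<beta>\<^sub>g\<close> and equations can be pulled back since \<open>\<iota>\<close> is
  injective.
\<close>

theorem is_unital_partial_action: "unital_partial_action k G S D \<alpha> u"
proof -
  have hom: "nonunital_algebra_hom k S (D (inv g)) S (D g) (\<alpha> g) \<and> bij_betw (\<alpha> g) (D (inv g)) (D g)"
    if g: "g \<in> carrier G" for g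
  proof
    have sub: "x \<in> carrier S" if "x \<in> D (inv g)" for x
      using that g domain_subset[of "inv g"] by auto
    have idl: "ideal (D (inv g)) S"
      using g unit_closed[of "inv g"] by (simp add: domain_eq cring.cgenideal_ideal[OF S.M_cring])
    then have cl: "x \<oplus>\<^bsub>S\<^esub> y \<in> D (inv g)" "x \<otimes>\<^bsub>S\<^esub> y \<in> D (inv g)"
      if "x \<in> D (inv g)" "y \<in> D (inv g)" for x y
      using that sub by (auto intro: ideal.I_l_closed additive_subgroup.a_closed ideal.axioms)
    have scl: "c \<odot>\<^bsub>S\<^esub> x \<in> D (inv g)" if "c \<in> carrier k" "x \<in> D (inv g)" for c x
      using that g by (simp add: in_domain_iff emb_smult T.smult_assoc2)
    have eqI: "\<alpha> g x = y" if "x \<in> D (inv g)" "y \<in> carrier S" "\<iota> y = \<beta> g (\<iota> x)" for x y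
      using that emb_map_domain[OF g] map_closed[OF g] emb_eq_iff by metis
    show "nonunital_algebra_hom k S (D (inv g)) S (D g) (\<alpha> g)"
      unfolding nonunital_algebra_hom_def
      by (auto intro!: map_in_domain[OF g] eqI cl scl
        simp: emb_add emb_mult emb_smult map_closed[OF g] emb_map_domain[OF g] act_add act_mult act_smult g sub)
    show "bij_betw (\<alpha> g) (D (inv g)) (D g)"
      using map_in_domain[OF g] map_inverse[OF g] map_inverse(2)[of "inv g"] g
      by (intro bij_betwI[where g = "\<alpha> (inv g)"]) auto
  qed
  have one: "D \<one> = carrier S"
    by (auto simp: in_domain_iff)
  have id: "\<alpha> \<one> x = x" if "x \<in> carrier S" for x
    using emb_map_domain[of \<one> x] map_closed[of \<one> x] that one emb_eq_iff by simp
  have comp: "\<alpha> g (\<alpha> h x) = \<alpha> (g \<otimes> h) x"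
    if g: "g \<in> carrier G" and h: "h \<in> carrier G" and x: "x \<in> \<alpha> (inv h) ` (D h \<inter> D (inv g))" for g h x
  proof -
    have "x \<in> D (inv h) \<inter> D (inv h \<otimes> inv g)"
      using x map_image_domains[of "inv h" "inv g"] g h by simp
    then have x': "x \<in> D (inv h)" "x \<in> D (inv (g \<otimes> h))"
      using g h by (auto simp: inv_mult_group)
    obtain y where y: "y \<in> D h" "y \<in> D (inv g)" "x = \<alpha> (inv h) y" using x by auto
    then have hx: "\<alpha> h x \<in> D (inv g)"
      using map_inverse(2)[OF h] by auto
    have "\<iota> (\<alpha> g (\<alpha> h x)) = \<iota> (\<alpha> (g \<otimes> h) x)"
      using emb_map_domain[OF g hx] emb_map_domain[OF h x'(1)] emb_map_domain[OF _ x'(2)] g h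
        domain_subset[of "inv h"] x' by (simp add: act_act subset_eq)
    then show ?thesis
      using emb_eq_iff map_closed[OF g hx] map_closed[OF _ x'(2)] g h by simp
  qed
  have idem: "ideal (D g) S \<and> u g \<in> carrier S \<and> u g \<otimes>\<^bsub>S\<^esub> u g = u g" if g: "g \<in> carrier G" for g
  proof -
    have "u g \<in> D g"
      using unit_closed[OF g] by (simp add: domain_eq[OF g] ring.cgenideal_self[OF cring.axioms(1)[OF S.M_cring]])
    then have "\<iota> (u g \<otimes>\<^bsub>S\<^esub> u g) = \<iota> (u g)"
      using unit_closed[OF g] g emb_e[of "u g"]
      by (simp add: emb_mult in_domain_iff emb_unit[OF g] flip: T.m_assoc)
    then show ?thesis
      using emb_eq_iff unit_closed[OF g] by (simp add: domain_eq[OF g] cring.cgenideal_ideal[OF S.M_cring])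
  qed
  show ?thesis
    unfolding unital_partial_action_def partial_action_def
    by (intro conjI ballI; ((rule domain_eq; assumption) |
        simp add: group_axioms S.algebra_axioms hom one id comp map_image_domains idem))
qed

lemma emb_map_mult_unit:
  assumes "g \<in> carrier G" and "x \<in> carrier S"
  shows "\<alpha> g (x \<otimes>\<^bsub>S\<^esub> u (inv g)) \<in> carrier S"
    and "\<iota> (\<alpha> g (x \<otimes>\<^bsub>S\<^esub> u (inv g))) = \<beta> g (\<iota> x) \<otimes>\<^bsub>T\<^esub> e"
proof -
  have dom: "x \<otimes>\<^bsub>S\<^esub> u (inv g) \<in> D (inv g)"
    using assms by (auto simp: domain_eq cgenideal_def)
  then show "\<alpha> g (x \<otimes>\<^bsub>S\<^esub> u (inv g)) \<in> carrier S"
    using map_closed[OF assms(1)] by simp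
  have "\<iota> (x \<otimes>\<^bsub>S\<^esub> u (inv g)) = \<iota> x \<otimes>\<^bsub>T\<^esub> \<beta> (inv g) e"
    using assms unit_closed[of "inv g"] by (simp add: emb_mult emb_unit T.m_comm T.m_lcomm)
  then show "\<iota> (\<alpha> g (x \<otimes>\<^bsub>S\<^esub> u (inv g))) = \<beta> g (\<iota> x) \<otimes>\<^bsub>T\<^esub> e"
    using emb_map_domain[OF assms(1) dom] assms by (simp add: act_mult)
qed

lemma invariants_iff:
  "s \<in> invariants G S \<alpha> u \<longleftrightarrow>
    s \<in> carrier S \<and> (\<forall>g\<in>carrier G. \<beta> g (\<iota> s) \<otimes>\<^bsub>T\<^esub> e = \<iota> s \<otimes>\<^bsub>T\<^esub> \<beta> g e)"
proof -
  have "\<alpha> g (s \<otimes>\<^bsub>S\<^esub> u (inv g)) = s \<otimes>\<^bsub>S\<^esub> u g \<longleftrightarrow> \<beta> g (\<iota> s) \<otimes>\<^bsub>T\<^esub> e = \<iota> s \<otimes>\<^bsub>T\<^esub> \<beta> g e"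
    if "s \<in> carrier S" and "g \<in> carrier G" for g
  proof -
    have "\<iota> (s \<otimes>\<^bsub>S\<^esub> u g) = \<iota> s \<otimes>\<^bsub>T\<^esub> \<beta> g e"
      using that unit_closed[of g] by (simp add: emb_mult emb_unit T.m_comm T.m_lcomm)
    then show ?thesis
      using emb_map_mult_unit[of g s] that unit_closed[of g]
        emb_eq_iff[of "\<alpha> g (s \<otimes>\<^bsub>S\<^esub> u (inv g))" "s \<otimes>\<^bsub>S\<^esub> u g"] by simp
  qed
  then show ?thesis by (auto simp: invariants_def)
qed

text \<open>
  The factor \<open>e\<close> in \<open>\<iota>(\<alpha>\<^sub>g(y 1\<^bsub>g\<inverse>\<^esub>)) = \<beta>\<^sub>g(\<iota> y) e\<close> is absorbed by \<open>\<iota> x\<close>. Hence the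
  Galois equations can be moved between \<open>S\<close> and \<open>T\<close>.
\<close>

lemma emb_galois_sum:
  assumes "finite I" and "\<And>i. i \<in> I \<Longrightarrow> x i \<in> carrier S \<and> y i \<in> carrier S" and "g \<in> carrier G"
  shows "(\<Oplus>\<^bsub>S\<^esub>i\<in>I. x i \<otimes>\<^bsub>S\<^esub> \<alpha> g (y i \<otimes>\<^bsub>S\<^esub> u (inv g))) \<in> carrier S"
    and "\<iota> (\<Oplus>\<^bsub>S\<^esub>i\<in>I. x i \<otimes>\<^bsub>S\<^esub> \<alpha> g (y i \<otimes>\<^bsub>S\<^esub> u (inv g))) =
      (\<Oplus>\<^bsub>T\<^esub>i\<in>I. \<iota> (x i) \<otimes>\<^bsub>T\<^esub> \<beta> g (\<iota> (y i)))"
proof -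
  have cl: "x i \<otimes>\<^bsub>S\<^esub> \<alpha> g (y i \<otimes>\<^bsub>S\<^esub> u (inv g)) \<in> carrier S" if "i \<in> I" for i
    using emb_map_mult_unit(1)[OF assms(3)] assms(2)[OF that] by simp
  then show "(\<Oplus>\<^bsub>S\<^esub>i\<in>I. x i \<otimes>\<^bsub>S\<^esub> \<alpha> g (y i \<otimes>\<^bsub>S\<^esub> u (inv g))) \<in> carrier S"
    by (simp add: Pi_iff)
  have "\<iota> (x i \<otimes>\<^bsub>S\<^esub> \<alpha> g (y i \<otimes>\<^bsub>S\<^esub> u (inv g))) = \<iota> (x i) \<otimes>\<^bsub>T\<^esub> \<beta> g (\<iota> (y i))" if "i \<in> I" for i
    using emb_map_mult_unit[OF assms(3), of "y i"] assms(2)[OF that] assms(3)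
    by (simp add: emb_mult T.m_comm[of _ e])
  then show "\<iota> (\<Oplus>\<^bsub>S\<^esub>i\<in>I. x i \<otimes>\<^bsub>S\<^esub> \<alpha> g (y i \<otimes>\<^bsub>S\<^esub> u (inv g))) =
      (\<Oplus>\<^bsub>T\<^esub>i\<in>I. \<iota> (x i) \<otimes>\<^bsub>T\<^esub> \<beta> g (\<iota> (y i)))"
    using cl assms(2,3) emb_finsum[OF assms(1), of "\<lambda>i. x i \<otimes>\<^bsub>S\<^esub> \<alpha> g (y i \<otimes>\<^bsub>S\<^esub> u (inv g))"]
    by (simp add: Pi_iff cong: T.M.finsum_cong)
qed

end

lemma (in idempotent_restriction) restrict_subgroup:
  assumes "subgroup H G"
  shows "idempotent_restriction k (G\<lparr>carrier := H\<rparr>) T \<beta> S D \<alpha> u \<iota>"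
proof -
  interpret H: subgroup H G by fact
  interpret GH: group "G\<lparr>carrier := H\<rparr>"
    using H.subgroup_is_group group_axioms by blast
  show ?thesis
    by unfold_locales
      (simp_all add: act_add act_mult act_smult act_act emb_hom emb_inj emb_image unit_closed
        emb_unit domain_eq map_closed emb_map m_inv_consistent[OF assms])
qed

context idempotent_restriction
begin

text \<open>
  The defining equation of an invariant for \<open>g\<inverse>g'\<close>, translated by \<open>\<beta>\<^sub>g\<close>. In this symmetric form the
  translates \<open>\<beta>\<^sub>g(s)\<close> agree wherever the supports \<open>\<beta>\<^sub>g(e)\<close> overlap, which is why \<open>\<psi>\<^sub>H\<close> can glue them.
\<close>

lemma invariant_act_comm:
  assumes "s \<in> invariants G S \<alpha> u" and g: "g \<in> carrier G" "g' \<in> carrier G"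
  shows "\<beta> g (\<iota> s) \<otimes>\<^bsub>T\<^esub> \<beta> g' e = \<beta> g' (\<iota> s) \<otimes>\<^bsub>T\<^esub> \<beta> g e"
proof -
  have s: "s \<in> carrier S" "\<beta> (inv g \<otimes> g') (\<iota> s) \<otimes>\<^bsub>T\<^esub> e = \<iota> s \<otimes>\<^bsub>T\<^esub> \<beta> (inv g \<otimes> g') e"
    using assms by (auto simp: invariants_iff)
  have "g \<otimes> (inv g \<otimes> g') = g'"
    using g by (simp flip: m_assoc)
  then have "\<beta> g' (\<iota> s) \<otimes>\<^bsub>T\<^esub> \<beta> g e = \<beta> g (\<beta> (inv g \<otimes> g') (\<iota> s) \<otimes>\<^bsub>T\<^esub> e)"
    using s(1) g by (simp add: act_mult act_act)
  also have "\<dots> = \<beta> g (\<iota> s) \<otimes>\<^bsub>T\<^esub> \<beta> g' e"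
    unfolding s(2) using s(1) g \<open>g \<otimes> (inv g \<otimes> g') = g'\<close> by (simp add: act_mult act_act)
  finally show ?thesis by simp
qed

lemma invariants_subring: "subring (invariants G S \<alpha> u) S"
proof (rule S.subringI)
  show "invariants G S \<alpha> u \<subseteq> carrier S"
    by (auto simp: invariants_iff)
  show "\<one>\<^bsub>S\<^esub> \<in> invariants G S \<alpha> u"
    by (simp add: invariants_iff T.m_comm)
  fix s t
  assume st: "s \<in> invariants G S \<alpha> u" "t \<in> invariants G S \<alpha> u"
  then have cl: "s \<in> carrier S" "t \<in> carrier S"
    by (auto simp: invariants_iff)
  show "\<ominus>\<^bsub>S\<^esub> s \<in> invariants G S \<alpha> u"
    using st(1) by (simp add: invariants_iff emb_a_inv act_a_inv T.l_minus)
  show "s \<oplus>\<^bsub>S\<^esub> t \<in> invariants G S \<alpha> u"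
    using st by (simp add: invariants_iff emb_add act_add T.l_distr)
  have "\<beta> g (\<iota> (s \<otimes>\<^bsub>S\<^esub> t)) \<otimes>\<^bsub>T\<^esub> e = \<iota> (s \<otimes>\<^bsub>S\<^esub> t) \<otimes>\<^bsub>T\<^esub> \<beta> g e" if g: "g \<in> carrier G" for g
  proof -
    have eqs: "\<beta> g (\<iota> s) \<otimes>\<^bsub>T\<^esub> e = \<iota> s \<otimes>\<^bsub>T\<^esub> \<beta> g e" "\<beta> g (\<iota> t) \<otimes>\<^bsub>T\<^esub> e = \<iota> t \<otimes>\<^bsub>T\<^esub> \<beta> g e"
      using st g by (auto simp: invariants_iff)
    have "\<beta> g (\<iota> (s \<otimes>\<^bsub>S\<^esub> t)) \<otimes>\<^bsub>T\<^esub> e = \<beta> g (\<iota> s) \<otimes>\<^bsub>T\<^esub> (\<beta> g (\<iota> t) \<otimes>\<^bsub>T\<^esub> e)"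
      using cl g by (simp add: emb_mult act_mult T.m_assoc)
    also have "\<dots> = \<iota> t \<otimes>\<^bsub>T\<^esub> (\<beta> g (\<iota> s) \<otimes>\<^bsub>T\<^esub> \<beta> g e)"
      unfolding eqs using cl g by (simp add: T.m_lcomm)
    also have "\<dots> = \<iota> t \<otimes>\<^bsub>T\<^esub> (\<beta> g (\<iota> s) \<otimes>\<^bsub>T\<^esub> e)"
      using act_e_absorb[OF g cl(1)] cl g by (simp add: T.m_comm[of _ e])
    also have "\<dots> = \<iota> (s \<otimes>\<^bsub>S\<^esub> t) \<otimes>\<^bsub>T\<^esub> \<beta> g e"
      unfolding eqs using cl g by (simp add: emb_mult T.m_ac)
    finally show ?thesis .
  qed
  then show "s \<otimes>\<^bsub>S\<^esub> t \<in> invariants G S \<alpha> u"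
    using cl by (simp add: invariants_iff)
qed

lemma invariants_smult:
  assumes "c \<in> carrier k" and "s \<in> invariants G S \<alpha> u"
  shows "c \<odot>\<^bsub>S\<^esub> s \<in> invariants G S \<alpha> u"
  using assms by (simp add: invariants_iff emb_smult act_smult T.smult_assoc2)

end

text \<open>
  Only the formula for \<open>1\<^sub>g\<close> needs an argument: both \<open>1\<^sub>g\<close> and \<open>\<beta>\<^sub>g(e)e\<close> lie in the ideal
  \<open>S \<inter> \<beta>\<^sub>g(S)\<close>, and each of them is a unit for it, so they coincide.
\<close>

lemma globalization_idempotent_restriction:
  assumes upa: "unital_partial_action k G S D \<alpha> u" and glob: "globalization k G S D \<alpha> T \<beta> \<iota>"
  shows "idempotent_restriction k G T \<beta> S D \<alpha> u \<iota>"
proof -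
  interpret algebra_action k G T \<beta>
    using glob by (intro algebra_actionI_global_action) (simp add: globalization_def)
  interpret S: algebra k S
    using upa by (simp add: unital_partial_action_def partial_action_def)
  let ?e = "\<iota> \<one>\<^bsub>S\<^esub>"
  have hom: "nonunital_algebra_hom k S (carrier S) T (carrier T) \<iota>" and inj: "inj_on \<iota> (carrier S)"
    and idl: "ideal (\<iota> ` carrier S) T"
    and dom: "\<And>g. g \<in> carrier G \<Longrightarrow> \<iota> ` D g = \<iota> ` carrier S \<inter> \<beta> g ` \<iota> ` carrier S"
    and act: "\<And>g x. \<lbrakk>g \<in> carrier G; x \<in> D (inv\<^bsub>G\<^esub> g)\<rbrakk> \<Longrightarrow> \<beta> g (\<iota> x) = \<iota> (\<alpha> g x)"
    using glob by (auto simp: globalization_def)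
  have u: "u g \<in> carrier S" "u g \<otimes>\<^bsub>S\<^esub> u g = u g" "D g = PIdl\<^bsub>S\<^esub> (u g)" if "g \<in> carrier G" for g
    using upa that by (auto simp: unital_partial_action_def)
  have cl: "\<iota> x \<in> carrier T" if "x \<in> carrier S" for x
    using hom that by (auto simp: nonunital_algebra_hom_def)
  have mult: "\<iota> (x \<otimes>\<^bsub>S\<^esub> y) = \<iota> x \<otimes>\<^bsub>T\<^esub> \<iota> y" if "x \<in> carrier S" "y \<in> carrier S" for x y
    using hom that by (auto simp: nonunital_algebra_hom_def)
  have e: "\<iota> x \<otimes>\<^bsub>T\<^esub> ?e = \<iota> x" if "x \<in> carrier S" for x
    using mult[of x "\<one>\<^bsub>S\<^esub>"] that by simp
  have image: "\<iota> ` carrier S = {t \<in> carrier T. t \<otimes>\<^bsub>T\<^esub> ?e = t}"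
  proof (intro equalityI subsetI)
    fix t
    assume "t \<in> {t \<in> carrier T. t \<otimes>\<^bsub>T\<^esub> ?e = t}"
    then show "t \<in> \<iota> ` carrier S"
      using ideal.I_l_closed[OF idl, of ?e t] by auto
  qed (use cl e in auto)
  have D_sub: "D g \<subseteq> carrier S" if "g \<in> carrier G" for g
    using u[OF that] by (auto simp: cgenideal_def)
  have unit: "\<iota> (u g) = \<beta> g ?e \<otimes>\<^bsub>T\<^esub> ?e" if g: "g \<in> carrier G" for g
  proof -
    have ee: "?e \<otimes>\<^bsub>T\<^esub> ?e = ?e" by (simp add: e)
    have "u g \<in> D g"
      using u[OF g] by (simp add: S.cgenideal_self)
    then have "\<iota> (u g) \<in> \<iota> ` D g"
      by simp
    then have "\<iota> (u g) \<in> \<beta> g ` \<iota> ` carrier S"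
      unfolding dom[OF g] by simp
    then obtain y where y: "y \<in> carrier S" "\<iota> (u g) = \<beta> g (\<iota> y)" by auto
    have "\<iota> (u g) \<otimes>\<^bsub>T\<^esub> \<beta> g ?e = \<beta> g (\<iota> y \<otimes>\<^bsub>T\<^esub> ?e)"
      using y g by (simp add: act_mult cl)
    then have 1: "\<iota> (u g) \<otimes>\<^bsub>T\<^esub> \<beta> g ?e = \<iota> (u g)"
      using y e by simp
    have "\<beta> g ?e \<otimes>\<^bsub>T\<^esub> ?e \<in> \<iota> ` carrier S"
      unfolding image using g by (simp add: T.m_assoc cl ee)
    moreover have "\<beta> g ?e \<otimes>\<^bsub>T\<^esub> ?e \<in> \<beta> g ` \<iota> ` carrier S"
    proof (rule image_eqI)
      show "\<beta> g ?e \<otimes>\<^bsub>T\<^esub> ?e = \<beta> g (?e \<otimes>\<^bsub>T\<^esub> \<beta> (inv\<^bsub>G\<^esub> g) ?e)"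
        using g by (simp add: act_mult cl)
      have "?e \<otimes>\<^bsub>T\<^esub> \<beta> (inv\<^bsub>G\<^esub> g) ?e \<otimes>\<^bsub>T\<^esub> ?e = ?e \<otimes>\<^bsub>T\<^esub> \<beta> (inv\<^bsub>G\<^esub> g) ?e"
        using g ee T.m_comm[of ?e "\<beta> (inv\<^bsub>G\<^esub> g) ?e"] by (simp add: T.m_assoc cl)
      then show "?e \<otimes>\<^bsub>T\<^esub> \<beta> (inv\<^bsub>G\<^esub> g) ?e \<in> \<iota> ` carrier S"
        unfolding image using g by (simp add: cl)
    qed
    ultimately have "\<beta> g ?e \<otimes>\<^bsub>T\<^esub> ?e \<in> \<iota> ` D g"
      using dom[OF g] by simp
    then obtain d where d: "d \<in> carrier S" "\<beta> g ?e \<otimes>\<^bsub>T\<^esub> ?e = \<iota> (d \<otimes>\<^bsub>S\<^esub> u g)"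
      using u(3)[OF g] by (auto simp: cgenideal_def)
    have "\<beta> g ?e \<otimes>\<^bsub>T\<^esub> ?e \<otimes>\<^bsub>T\<^esub> \<iota> (u g) = \<iota> (d \<otimes>\<^bsub>S\<^esub> u g \<otimes>\<^bsub>S\<^esub> u g)"
      using d u(1)[OF g] by (simp add: mult)
    also have "\<dots> = \<iota> (d \<otimes>\<^bsub>S\<^esub> u g)"
      using d u[OF g] by (simp add: S.m_assoc)
    finally have "\<beta> g ?e \<otimes>\<^bsub>T\<^esub> ?e \<otimes>\<^bsub>T\<^esub> \<iota> (u g) = \<beta> g ?e \<otimes>\<^bsub>T\<^esub> ?e"
      using d by simp
    moreover have "\<beta> g ?e \<otimes>\<^bsub>T\<^esub> ?e \<otimes>\<^bsub>T\<^esub> \<iota> (u g) = \<iota> (u g) \<otimes>\<^bsub>T\<^esub> \<beta> g ?e \<otimes>\<^bsub>T\<^esub> ?e"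
      using g u(1)[OF g] by (simp add: T.m_ac cl)
    ultimately show ?thesis
      using 1 e[OF u(1)[OF g]] by simp
  qed
  have map: "\<alpha> g x \<in> carrier S" if "g \<in> carrier G" "x \<in> D (inv\<^bsub>G\<^esub> g)" for g x
  proof -
    have "partial_action k G S D \<alpha>"
      using upa by (simp add: unital_partial_action_def)
    then have "nonunital_algebra_hom k S (D (inv\<^bsub>G\<^esub> g)) S (D g) (\<alpha> g)"
      using that(1) by (simp add: partial_action_def)
    then have "\<alpha> g x \<in> D g"
      using that(2) by (auto simp: nonunital_algebra_hom_def)
    then show ?thesis using that(1) D_sub by auto
  qed
  show ?thesis
    using hom inj image u(1,3) unit map act e
    by unfold_locales simp_all
qed


section \<open>The idempotent \<open>f\<close> and the map \<open>\<psi>\<^sub>H\<close>\<close>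

locale quotient_restriction = idempotent_restriction k G T \<beta> S D \<alpha> u \<iota> + normal H G
  for k :: "('k, 'x) ring_scheme" and G :: "('g, 'z) monoid_scheme" (structure)
    and T :: "('k, 'b, 'w) module_scheme" and \<beta> :: "'g \<Rightarrow> 'b \<Rightarrow> 'b"
    and S :: "('k, 'a, 'y) module_scheme"
    and D :: "'g \<Rightarrow> 'a set" and \<alpha> :: "'g \<Rightarrow> 'a \<Rightarrow> 'a" and u :: "'g \<Rightarrow> 'a" and \<iota> :: "'a \<Rightarrow> 'b"
    and H :: "'g set" +
  fixes h :: "nat \<Rightarrow> 'g" and m :: nat
  assumes finite_group: "finite (carrier G)" and enum: "bij_betw h {1..m} H"
begin

abbreviation \<psi> where "\<psi> \<equiv> psi S T \<beta> \<iota> h m"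

abbreviation ei where "ei \<equiv> ortho_idem S T \<beta> \<iota> h"

abbreviation f where "f \<equiv> \<psi> \<one>\<^bsub>T\<^esub>"

lemma enum_mem: "i \<in> {1..m} \<Longrightarrow> h i \<in> H"
  using enum by (auto simp: bij_betw_def)

lemma enum_closed: "i \<in> {1..m} \<Longrightarrow> h i \<in> carrier G"
  by (simp add: enum_mem)

lemma ei_closed: "i \<in> {1..m} \<Longrightarrow> ei i \<in> carrier T"
  unfolding ortho_idem_def using enum_closed
  by (intro T.m_closed T.finprod_closed T.minus_closed Pi_I act_closed emb_closed) auto

lemma ei_absorb: "i \<in> {1..m} \<Longrightarrow> ei i \<otimes>\<^bsub>T\<^esub> \<beta> (h i) e = ei i"
proof -
  assume i: "i \<in> {1..m}"
  have "(\<Otimes>\<^bsub>T\<^esub>j\<in>{1..<i}. \<one>\<^bsub>T\<^esub> \<ominus>\<^bsub>T\<^esub> \<beta> (h j) e) \<in> carrier T"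
    using enum_closed i by (intro T.finprod_closed T.minus_closed Pi_I act_closed emb_closed) auto
  then show ?thesis
    unfolding ortho_idem_def using i enum_closed[OF i] act_e_absorb[of "h i" "\<one>\<^bsub>S\<^esub>"]
    by (simp add: T.m_assoc)
qed

lemma psi_closed [simp, intro]: "t \<in> carrier T \<Longrightarrow> \<psi> t \<in> carrier T"
  unfolding psi_def using enum_closed ei_closed by (intro T.M.finsum_closed) auto

lemma f_eq: "f = (\<Oplus>\<^bsub>T\<^esub>i\<in>{1..m}. ei i)"
  unfolding psi_def using enum_closed ei_closed by (intro T.M.finsum_cong') auto

text \<open>
  A telescoping sum: \<open>e\<^bsub>n+1\<^esub> = p b\<close>, where \<open>b\<close> is the translate of \<open>e\<close> by \<open>h\<^bsub>n+1\<^esub>\<close> and \<open>p\<close> the product of the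
  first \<open>n\<close> complements, and \<open>p b + (1 - p) = 1 - (1 - b) p\<close>. Thus \<open>1 - f\<close> is the product of all \<open>1 - \<beta>\<^sub>h(e)\<close>.
\<close>

lemma sum_ei:
  "n \<le> m \<Longrightarrow> (\<Oplus>\<^bsub>T\<^esub>i\<in>{1..n}. ei i) =
    \<one>\<^bsub>T\<^esub> \<ominus>\<^bsub>T\<^esub> (\<Otimes>\<^bsub>T\<^esub>j\<in>{1..<Suc n}. \<one>\<^bsub>T\<^esub> \<ominus>\<^bsub>T\<^esub> \<beta> (h j) e)"
proof (induction n)
  case 0
  show ?case by (simp add: T.minus_eq T.r_neg)
next
  case (Suc n)
  let ?P = "\<Otimes>\<^bsub>T\<^esub>j\<in>{1..<Suc n}. \<one>\<^bsub>T\<^esub> \<ominus>\<^bsub>T\<^esub> \<beta> (h j) e"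
  let ?b = "\<beta> (h (Suc n)) e"
  have cl: "\<one>\<^bsub>T\<^esub> \<ominus>\<^bsub>T\<^esub> \<beta> (h j) e \<in> carrier T" if "j \<in> {1..Suc n}" for j
    using enum_closed[of j] that Suc.prems by (intro T.minus_closed) auto
  have P: "?P \<in> carrier T"
    using cl by (intro T.finprod_closed) auto
  have b: "?b \<in> carrier T"
    using enum_closed[of "Suc n"] Suc.prems by simp
  have "{1..<Suc (Suc n)} = insert (Suc n) {1..<Suc n}" by auto
  then have "(\<Otimes>\<^bsub>T\<^esub>j\<in>{1..<Suc (Suc n)}. \<one>\<^bsub>T\<^esub> \<ominus>\<^bsub>T\<^esub> \<beta> (h j) e) = (\<one>\<^bsub>T\<^esub> \<ominus>\<^bsub>T\<^esub> ?b) \<otimes>\<^bsub>T\<^esub> ?P"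
    using cl by simp
  moreover have "{1..Suc n} = insert (Suc n) {1..n}" by auto
  then have "(\<Oplus>\<^bsub>T\<^esub>i\<in>{1..Suc n}. ei i) = ei (Suc n) \<oplus>\<^bsub>T\<^esub> (\<Oplus>\<^bsub>T\<^esub>i\<in>{1..n}. ei i)"
    using ei_closed Suc.prems by simp
  moreover have "ei (Suc n) = ?P \<otimes>\<^bsub>T\<^esub> ?b"
    by (simp add: ortho_idem_def)
  moreover have "?P \<otimes>\<^bsub>T\<^esub> ?b \<oplus>\<^bsub>T\<^esub> (\<one>\<^bsub>T\<^esub> \<ominus>\<^bsub>T\<^esub> ?P) = \<one>\<^bsub>T\<^esub> \<ominus>\<^bsub>T\<^esub> (\<one>\<^bsub>T\<^esub> \<ominus>\<^bsub>T\<^esub> ?b) \<otimes>\<^bsub>T\<^esub> ?P"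
    using T.complement_mult_complement[OF P b] .
  ultimately show ?case
    using Suc by simp
qed

text \<open>
  The product \<open>1 - f\<close> contains the factor \<open>1 - \<beta>\<^sub>l(e)\<close>, which is orthogonal to \<open>\<beta>\<^sub>l(e)\<close>.
\<close>

lemma act_e_f:
  assumes "l \<in> H"
  shows "\<beta> l e \<otimes>\<^bsub>T\<^esub> f = \<beta> l e"
proof -
  obtain j where j: "j \<in> {1..m}" "l = h j"
    using assms enum by (auto simp: bij_betw_def)
  let ?F = "\<lambda>j. \<one>\<^bsub>T\<^esub> \<ominus>\<^bsub>T\<^esub> \<beta> (h j) e"
  let ?Q = "\<Otimes>\<^bsub>T\<^esub>j\<in>{1..<Suc m} - {j}. ?F j"
  have cl: "?F i \<in> carrier T" if "i \<in> {1..m}" for i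
    using enum_closed[OF that] by (intro T.minus_closed) auto
  have b: "\<beta> l e \<in> carrier T" "\<beta> l e \<otimes>\<^bsub>T\<^esub> \<beta> l e = \<beta> l e"
    using assms act_e_absorb[of l "\<one>\<^bsub>S\<^esub>"] by auto
  have Q: "?Q \<in> carrier T"
    using cl by (intro T.finprod_closed) auto
  have "{1..<Suc m} = insert j ({1..<Suc m} - {j})"
    using j by auto
  then have "(\<Otimes>\<^bsub>T\<^esub>j\<in>{1..<Suc m}. ?F j) = (\<Otimes>\<^bsub>T\<^esub>j\<in>insert j ({1..<Suc m} - {j}). ?F j)"
    by simp
  also have "\<dots> = ?F j \<otimes>\<^bsub>T\<^esub> ?Q"
    using cl j(1) by (intro T.finprod_insert) auto
  finally have "f = \<one>\<^bsub>T\<^esub> \<ominus>\<^bsub>T\<^esub> (\<one>\<^bsub>T\<^esub> \<ominus>\<^bsub>T\<^esub> \<beta> l e) \<otimes>\<^bsub>T\<^esub> ?Q"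
    using sum_ei[of m] j by (simp add: f_eq)
  then show ?thesis
    using T.idempotent_absorbs_complement[OF b Q] by simp
qed

lemma mult_f:
  assumes "t \<in> carrier T"
  shows "t \<otimes>\<^bsub>T\<^esub> f = (\<Oplus>\<^bsub>T\<^esub>i\<in>{1..m}. t \<otimes>\<^bsub>T\<^esub> ei i)"
  unfolding f_eq using assms ei_closed by (intro T.finsum_rdistr) auto

text \<open>
  The summand \<open>e\<^sub>i\<close> of \<open>f\<close> is a multiple of \<open>\<beta>\<^bsub>h\<^sub>i\<^esub>(e)\<close>, so an element of \<open>Tf\<close> is determined by its
  products with the \<open>\<beta>\<^sub>l(e)\<close>.
\<close>

lemma eq_on_f_support:
  assumes "s \<in> carrier T" and "t \<in> carrier T" and "s \<otimes>\<^bsub>T\<^esub> f = s" and "t \<otimes>\<^bsub>T\<^esub> f = t"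
    and eq: "\<And>l. l \<in> H \<Longrightarrow> s \<otimes>\<^bsub>T\<^esub> \<beta> l e = t \<otimes>\<^bsub>T\<^esub> \<beta> l e"
  shows "s = t"
proof -
  have swap: "r \<otimes>\<^bsub>T\<^esub> ei i = (r \<otimes>\<^bsub>T\<^esub> \<beta> (h i) e) \<otimes>\<^bsub>T\<^esub> ei i" if "i \<in> {1..m}" "r \<in> carrier T" for r i
  proof -
    have "r \<otimes>\<^bsub>T\<^esub> ei i = r \<otimes>\<^bsub>T\<^esub> (ei i \<otimes>\<^bsub>T\<^esub> \<beta> (h i) e)"
      using ei_absorb that by simp
    then show ?thesis
      using that ei_closed enum_closed by (simp add: T.m_ac)
  qed
  have "s \<otimes>\<^bsub>T\<^esub> ei i = t \<otimes>\<^bsub>T\<^esub> ei i" if "i \<in> {1..m}" for i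
    using swap[OF that assms(1)] swap[OF that assms(2)] eq[OF enum_mem[OF that]] by simp
  then have "(\<Oplus>\<^bsub>T\<^esub>i\<in>{1..m}. s \<otimes>\<^bsub>T\<^esub> ei i) = (\<Oplus>\<^bsub>T\<^esub>i\<in>{1..m}. t \<otimes>\<^bsub>T\<^esub> ei i)"
    using assms(2) ei_closed by (intro T.M.finsum_cong') auto
  then show ?thesis
    using mult_f[OF assms(1)] mult_f[OF assms(2)] assms(3,4) by simp
qed

lemma psi_f:
  assumes "t \<in> carrier T"
  shows "\<psi> t \<otimes>\<^bsub>T\<^esub> f = \<psi> t"
proof -
  have *: "ei i \<otimes>\<^bsub>T\<^esub> f = ei i" if "i \<in> {1..m}" for i
  proof -
    have "ei i \<otimes>\<^bsub>T\<^esub> f = ei i \<otimes>\<^bsub>T\<^esub> \<beta> (h i) e \<otimes>\<^bsub>T\<^esub> f"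
      using ei_absorb[OF that] by simp
    also have "\<dots> = ei i \<otimes>\<^bsub>T\<^esub> (\<beta> (h i) e \<otimes>\<^bsub>T\<^esub> f)"
      using ei_closed[OF that] enum_closed[OF that] by (intro T.m_assoc) auto
    also have "\<dots> = ei i"
      using act_e_f[OF enum_mem[OF that]] ei_absorb[OF that] by simp
    finally show ?thesis .
  qed
  have "\<psi> t \<otimes>\<^bsub>T\<^esub> f = (\<Oplus>\<^bsub>T\<^esub>i\<in>{1..m}. \<beta> (h i) t \<otimes>\<^bsub>T\<^esub> ei i \<otimes>\<^bsub>T\<^esub> f)"
    unfolding psi_def[of S T \<beta> \<iota> h m t] using assms ei_closed enum_closed
    by (intro T.finsum_ldistr) auto
  also have "\<dots> = \<psi> t"
    unfolding psi_def[of S T \<beta> \<iota> h m t] using assms ei_closed enum_closed *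
    by (intro T.M.finsum_cong') (auto simp: T.m_assoc)
  finally show ?thesis .
qed

text \<open>
  In \<open>\<psi>\<^sub>H(s) \<beta>\<^sub>g(e) = \<Sum> \<beta>\<^bsub>h\<^sub>i\<^esub>(s) \<beta>\<^sub>g(e) e\<^sub>i\<close> the hypothesis turns each term into
  \<open>\<beta>\<^sub>g(s) \<beta>\<^bsub>h\<^sub>i\<^esub>(e) e\<^sub>i = \<beta>\<^sub>g(s) e\<^sub>i\<close>. It is used with \<open>g \<in> H\<close> for \<open>H\<close>-invariants and with arbitrary \<open>g\<close>
  for \<open>G\<close>-invariants.
\<close>

lemma psi_mult_act:
  assumes s: "s \<in> carrier S" and g: "g \<in> carrier G"
    and comm: "\<And>l. l \<in> H \<Longrightarrow> \<beta> l (\<iota> s) \<otimes>\<^bsub>T\<^esub> \<beta> g e = \<beta> g (\<iota> s) \<otimes>\<^bsub>T\<^esub> \<beta> l e"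
  shows "\<psi> (\<iota> s) \<otimes>\<^bsub>T\<^esub> \<beta> g e = \<beta> g (\<iota> s) \<otimes>\<^bsub>T\<^esub> f"
proof -
  have "\<psi> (\<iota> s) \<otimes>\<^bsub>T\<^esub> \<beta> g e = (\<Oplus>\<^bsub>T\<^esub>i\<in>{1..m}. \<beta> (h i) (\<iota> s) \<otimes>\<^bsub>T\<^esub> ei i \<otimes>\<^bsub>T\<^esub> \<beta> g e)"
    unfolding psi_def[of S T \<beta> \<iota> h m "\<iota> s"] using s g ei_closed enum_closed
    by (intro T.finsum_ldistr) auto
  also have "\<dots> = (\<Oplus>\<^bsub>T\<^esub>i\<in>{1..m}. \<beta> g (\<iota> s) \<otimes>\<^bsub>T\<^esub> ei i)"
  proof (intro T.M.finsum_cong')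
    fix i
    assume i: "i \<in> {1..m}"
    have "\<beta> (h i) (\<iota> s) \<otimes>\<^bsub>T\<^esub> ei i \<otimes>\<^bsub>T\<^esub> \<beta> g e = \<beta> (h i) (\<iota> s) \<otimes>\<^bsub>T\<^esub> \<beta> g e \<otimes>\<^bsub>T\<^esub> ei i"
      using s g ei_closed[OF i] enum_closed[OF i] by (simp add: T.m_ac)
    also have "\<dots> = \<beta> g (\<iota> s) \<otimes>\<^bsub>T\<^esub> \<beta> (h i) e \<otimes>\<^bsub>T\<^esub> ei i"
      using comm[OF enum_mem[OF i]] by simp
    also have "\<dots> = \<beta> g (\<iota> s) \<otimes>\<^bsub>T\<^esub> (ei i \<otimes>\<^bsub>T\<^esub> \<beta> (h i) e)"
      using s g ei_closed[OF i] enum_closed[OF i] by (simp add: T.m_ac)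
    finally show "\<beta> (h i) (\<iota> s) \<otimes>\<^bsub>T\<^esub> ei i \<otimes>\<^bsub>T\<^esub> \<beta> g e = \<beta> g (\<iota> s) \<otimes>\<^bsub>T\<^esub> ei i"
      using ei_absorb[OF i] by simp
  qed (use s g ei_closed in auto)
  also have "\<dots> = \<beta> g (\<iota> s) \<otimes>\<^bsub>T\<^esub> f"
    using mult_f s g by simp
  finally show ?thesis .
qed

end


section \<open>Invariants under a normal subgroup inside the fixed ring\<close>

sublocale quotient_restriction \<subseteq> H: idempotent_restriction k "G\<lparr>carrier := H\<rparr>" T \<beta> S D \<alpha> u \<iota>
  by (rule restrict_subgroup[OF subgroup_axioms])

context quotient_restriction
begin

abbreviation S_H where "S_H \<equiv> invariant_algebra (G\<lparr>carrier := H\<rparr>) S \<alpha> u"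

lemma S_H_carrier_iff: "s \<in> carrier S_H \<longleftrightarrow>
    s \<in> carrier S \<and> (\<forall>l\<in>H. \<beta> l (\<iota> s) \<otimes>\<^bsub>T\<^esub> e = \<iota> s \<otimes>\<^bsub>T\<^esub> \<beta> l e)"
  by (simp add: invariant_algebra_def H.invariants_iff)

lemma S_H_carrier: "carrier S_H = invariants (G\<lparr>carrier := H\<rparr>) S \<alpha> u"
  by (simp add: invariant_algebra_def)

lemma S_H_simps [simp]: "\<one>\<^bsub>S_H\<^esub> = \<one>\<^bsub>S\<^esub>" "x \<oplus>\<^bsub>S_H\<^esub> y = x \<oplus>\<^bsub>S\<^esub> y" "x \<otimes>\<^bsub>S_H\<^esub> y = x \<otimes>\<^bsub>S\<^esub> y"
  "c \<odot>\<^bsub>S_H\<^esub> x = c \<odot>\<^bsub>S\<^esub> x" "\<zero>\<^bsub>S_H\<^esub> = \<zero>\<^bsub>S\<^esub>"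
  by (simp_all add: invariant_algebra_def)

lemma S_H_algebra: "algebra k S_H"
  unfolding invariant_algebra_def
  by (intro S.algebra_restrict_carrier H.invariants_subring H.invariants_smult)

lemma S_H_closed [simp]: "s \<in> carrier S_H \<Longrightarrow> s \<in> carrier S"
  by (simp add: S_H_carrier_iff)

definition fixed :: "'b set" where
  "fixed = {t \<in> carrier T. \<forall>l\<in>H. \<beta> l t = t}"

lemma fixed_subring: "subring fixed T"
  by (rule T.subringI) (auto simp: fixed_def act_add act_mult act_a_inv)

lemma fixedI: "\<lbrakk>t \<in> carrier T; \<And>l. l \<in> H \<Longrightarrow> \<beta> l t = t\<rbrakk> \<Longrightarrow> t \<in> fixed"
  and fixed_mult: "\<lbrakk>s \<in> fixed; t \<in> fixed\<rbrakk> \<Longrightarrow> s \<otimes>\<^bsub>T\<^esub> t \<in> fixed"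
  and fixed_add: "\<lbrakk>s \<in> fixed; t \<in> fixed\<rbrakk> \<Longrightarrow> s \<oplus>\<^bsub>T\<^esub> t \<in> fixed"
  and fixed_smult: "\<lbrakk>c \<in> carrier k; t \<in> fixed\<rbrakk> \<Longrightarrow> c \<odot>\<^bsub>T\<^esub> t \<in> fixed"
  by (auto simp: fixed_def act_add act_mult act_smult)

lemma fixed_closed [simp]: "t \<in> fixed \<Longrightarrow> t \<in> carrier T"
  and act_fixed [simp]: "\<lbrakk>l \<in> H; t \<in> fixed\<rbrakk> \<Longrightarrow> \<beta> l t = t"
  by (auto simp: fixed_def)

abbreviation T_H where "T_H \<equiv> T\<lparr>carrier := fixed\<rparr>"

lemma T_H_algebra: "algebra k T_H"
  by (intro T.algebra_restrict_carrier fixed_subring fixed_smult)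

text \<open>
  Both \<open>\<beta>\<^sub>l(f)\<close> and \<open>f\<close> are units for all \<open>\<beta>\<^sub>j(e)\<close> with \<open>j \<in> H\<close>, so \<open>\<beta>\<^sub>l(f) f = f\<close>; applying \<open>\<beta>\<^sub>l\<close> to the
  same equation for \<open>l\<inverse>\<close> gives \<open>f \<beta>\<^sub>l(f) = \<beta>\<^sub>l(f)\<close>.
\<close>

lemma act_f:
  assumes l: "l \<in> H"
  shows "\<beta> l f = f"
proof -
  have ff: "f \<otimes>\<^bsub>T\<^esub> f = f"
    by (simp add: psi_f)
  have absorb: "\<beta> l' f \<otimes>\<^bsub>T\<^esub> f = f" if l': "l' \<in> H" for l'
  proof (rule eq_on_f_support)
    fix j
    assume j: "j \<in> H"
    have j': "inv l' \<otimes> j \<in> H" using l' j by simp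
    have "\<beta> l' (\<beta> (inv l' \<otimes> j) e \<otimes>\<^bsub>T\<^esub> f) = \<beta> j e \<otimes>\<^bsub>T\<^esub> \<beta> l' f"
      using l' j by (simp add: act_mult act_act flip: m_assoc)
    then have "\<beta> j e \<otimes>\<^bsub>T\<^esub> \<beta> l' f = \<beta> j e"
      unfolding act_e_f[OF j'] using l' j by (simp add: act_act flip: m_assoc)
    then have "\<beta> l' f \<otimes>\<^bsub>T\<^esub> (\<beta> j e \<otimes>\<^bsub>T\<^esub> f) = \<beta> j e \<otimes>\<^bsub>T\<^esub> f"
      using act_e_f[OF j] l' j by (simp add: T.m_comm)
    then show "\<beta> l' f \<otimes>\<^bsub>T\<^esub> f \<otimes>\<^bsub>T\<^esub> \<beta> j e = f \<otimes>\<^bsub>T\<^esub> \<beta> j e"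
      using l' j by (simp add: T.m_ac)
  qed (use l' ff in \<open>auto simp: T.m_assoc\<close>)
  have "\<beta> l (\<beta> (inv l) f \<otimes>\<^bsub>T\<^esub> f) = f \<otimes>\<^bsub>T\<^esub> \<beta> l f"
    using l by (simp add: act_mult)
  then have "\<beta> l f = f \<otimes>\<^bsub>T\<^esub> \<beta> l f"
    using absorb[of "inv l"] l by simp
  also have "\<dots> = \<beta> l f \<otimes>\<^bsub>T\<^esub> f"
    using l by (intro T.m_comm) auto
  also have "\<dots> = f"
    using absorb[OF l] .
  finally show ?thesis .
qed

lemma f_fixed [simp]: "f \<in> fixed"
  by (rule fixedI) (simp_all add: act_f)

lemma f_idem [simp]: "f \<otimes>\<^bsub>T\<^esub> f = f"
  by (simp add: psi_f)

lemma e_f [simp]: "e \<otimes>\<^bsub>T\<^esub> f = e"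
  using act_e_f[of \<one>] by simp

lemma f_e [simp]: "f \<otimes>\<^bsub>T\<^esub> e = e"
  by (subst T.m_comm) auto

text \<open>
  This characterizes \<open>\<psi>\<^sub>H(s)\<close>, an element of \<open>Tf\<close>, as the gluing of the translates of \<open>s\<close>.
\<close>

lemma psi_mult_act_H:
  assumes s: "s \<in> carrier S_H" and l: "l \<in> H"
  shows "\<psi> (\<iota> s) \<otimes>\<^bsub>T\<^esub> \<beta> l e = \<beta> l (\<iota> s)"
proof -
  have "\<psi> (\<iota> s) \<otimes>\<^bsub>T\<^esub> \<beta> l e = \<beta> l (\<iota> s) \<otimes>\<^bsub>T\<^esub> f"
  proof (rule psi_mult_act)
    fix j
    assume "j \<in> H"
    then show "\<beta> j (\<iota> s) \<otimes>\<^bsub>T\<^esub> \<beta> l e = \<beta> l (\<iota> s) \<otimes>\<^bsub>T\<^esub> \<beta> j e"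
      using H.invariant_act_comm[of s j l] s l unfolding S_H_carrier by simp
  qed (use s l in auto)
  also have "\<dots> = \<beta> l (\<iota> s) \<otimes>\<^bsub>T\<^esub> \<beta> l e \<otimes>\<^bsub>T\<^esub> f"
    using s l act_e_absorb[of l s] by simp
  also have "\<dots> = \<beta> l (\<iota> s) \<otimes>\<^bsub>T\<^esub> (\<beta> l e \<otimes>\<^bsub>T\<^esub> f)"
    using s l by (intro T.m_assoc) auto
  also have "\<dots> = \<beta> l (\<iota> s)"
    using s l act_e_absorb[of l s] act_e_f[OF l] by simp
  finally show ?thesis .
qed

lemma psi_mult_e:
  assumes "s \<in> carrier S_H"
  shows "\<psi> (\<iota> s) \<otimes>\<^bsub>T\<^esub> e = \<iota> s"
  using psi_mult_act_H[OF assms, of \<one>] assms by simp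

text \<open>
  An automorphism \<open>\<beta>\<^sub>l\<close> permutes the conditions \<open>\<psi>\<^sub>H(s) \<beta>\<^sub>j(e) = \<beta>\<^sub>j(s)\<close>, which determine \<open>\<psi>\<^sub>H(s)\<close>.
\<close>

lemma psi_fixed [simp]:
  assumes s: "s \<in> carrier S_H"
  shows "\<psi> (\<iota> s) \<in> fixed"
proof -
  have "\<beta> l (\<psi> (\<iota> s)) = \<psi> (\<iota> s)" if l: "l \<in> H" for l
  proof (rule eq_on_f_support)
    have "\<beta> l (\<psi> (\<iota> s) \<otimes>\<^bsub>T\<^esub> f) = \<beta> l (\<psi> (\<iota> s)) \<otimes>\<^bsub>T\<^esub> f"
      using s l by (simp add: act_mult del: f_idem)
    then show "\<beta> l (\<psi> (\<iota> s)) \<otimes>\<^bsub>T\<^esub> f = \<beta> l (\<psi> (\<iota> s))"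
      using s psi_f[of "\<iota> s"] by simp
  next
    fix j
    assume j: "j \<in> H"
    have j': "inv l \<otimes> j \<in> H" using l j by simp
    have "\<beta> l (\<psi> (\<iota> s) \<otimes>\<^bsub>T\<^esub> \<beta> (inv l \<otimes> j) e) = \<beta> l (\<psi> (\<iota> s)) \<otimes>\<^bsub>T\<^esub> \<beta> j e"
      using s l j by (simp add: act_mult act_act flip: m_assoc)
    then have "\<beta> l (\<psi> (\<iota> s)) \<otimes>\<^bsub>T\<^esub> \<beta> j e = \<beta> j (\<iota> s)"
      unfolding psi_mult_act_H[OF s j'] using s l j by (simp add: act_act flip: m_assoc)
    then show "\<beta> l (\<psi> (\<iota> s)) \<otimes>\<^bsub>T\<^esub> \<beta> j e = \<psi> (\<iota> s) \<otimes>\<^bsub>T\<^esub> \<beta> j e"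
      using psi_mult_act_H[OF s j] by simp
  qed (use s l psi_f in auto)
  then show ?thesis
    using s by (intro fixedI) simp_all
qed

lemma fixed_mult_e_preimage:
  assumes t: "t \<in> fixed"
  obtains s where "s \<in> carrier S_H" and "\<iota> s = t \<otimes>\<^bsub>T\<^esub> e"
proof -
  obtain s where s: "s \<in> carrier S" "\<iota> s = t \<otimes>\<^bsub>T\<^esub> e"
    using t by (rule_tac preimage[of "t \<otimes>\<^bsub>T\<^esub> e"]) (auto simp: T.m_assoc)
  have "\<beta> l (\<iota> s) \<otimes>\<^bsub>T\<^esub> e = \<iota> s \<otimes>\<^bsub>T\<^esub> \<beta> l e" if "l \<in> H" for l
    unfolding s(2) using t that by (simp add: act_mult T.m_assoc T.m_comm[of e])
  then show thesis
    using that[OF _ s(2)] s(1) unfolding S_H_carrier_iff by blast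
qed

text \<open>
  Together with \<open>psi_mult_e\<close> this says that \<open>\<psi>\<^sub>H\<close> and \<open>t \<mapsto> te\<close> are mutually inverse between
  \<open>S\<^bsup>\<alpha>\<^sub>H\<^esup>\<close> and \<open>T\<^sup>H f\<close>. To compute \<open>\<psi>\<^sub>H\<close> of anything it is enough to exhibit an element of \<open>T\<^sup>H\<close> that
  restricts to it.
\<close>

lemma psi_fixed_mult_e:
  assumes s: "s \<in> carrier S_H" and t: "t \<in> fixed" and eq: "\<iota> s = t \<otimes>\<^bsub>T\<^esub> e"
  shows "\<psi> (\<iota> s) = t \<otimes>\<^bsub>T\<^esub> f"
proof (rule eq_on_f_support)
  fix l
  assume l: "l \<in> H"
  have "\<beta> l (\<iota> s) = t \<otimes>\<^bsub>T\<^esub> \<beta> l e"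
    unfolding eq using t l by (simp add: act_mult)
  moreover have "t \<otimes>\<^bsub>T\<^esub> (\<beta> l e \<otimes>\<^bsub>T\<^esub> f) = t \<otimes>\<^bsub>T\<^esub> f \<otimes>\<^bsub>T\<^esub> \<beta> l e"
    using t l by (simp add: T.m_ac)
  ultimately show "\<psi> (\<iota> s) \<otimes>\<^bsub>T\<^esub> \<beta> l e = t \<otimes>\<^bsub>T\<^esub> f \<otimes>\<^bsub>T\<^esub> \<beta> l e"
    using psi_mult_act_H[OF s l] act_e_f[OF l] by simp
qed (use s t in \<open>auto simp: psi_f T.m_assoc\<close>)

lemma fixed_eqI:
  assumes "s \<in> fixed" and "t \<in> fixed" and "s \<otimes>\<^bsub>T\<^esub> f = s" and "t \<otimes>\<^bsub>T\<^esub> f = t" and "s \<otimes>\<^bsub>T\<^esub> e = t \<otimes>\<^bsub>T\<^esub> e"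
  shows "s = t"
proof -
  obtain x where "x \<in> carrier S_H" "\<iota> x = s \<otimes>\<^bsub>T\<^esub> e"
    using assms(1) by (rule fixed_mult_e_preimage)
  then show ?thesis
    using psi_fixed_mult_e[of x s] psi_fixed_mult_e[of x t] assms by simp
qed

end


section \<open>The action of the quotient group\<close>

context quotient_restriction
begin

lemma quotient_carrier: "carrier (G Mod H) = (\<lambda>g. g <# H) ` carrier G"
  using coset_eq by (simp add: carrier_FactGroup)

lemma coset_in_quotient: "g \<in> carrier G \<Longrightarrow> g <# H \<in> carrier (G Mod H)"
  by (simp add: quotient_carrier)

lemma quotient_cosetE:
  assumes "A \<in> carrier (G Mod H)"
  obtains g where "g \<in> carrier G" and "A = g <# H"
  using assms by (auto simp: quotient_carrier)

lemma coset_mult: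
  "\<lbrakk>g \<in> carrier G; g' \<in> carrier G\<rbrakk> \<Longrightarrow> (g <# H) <#> (g' <# H) = (g \<otimes> g') <# H"
  using coset_eq rcos_sum[of g g'] by simp

lemma coset_inv: "g \<in> carrier G \<Longrightarrow> inv\<^bsub>G Mod H\<^esub> (g <# H) = inv g <# H"
  using inv_FactGroup[OF coset_in_quotient] coset_eq rcos_inv[of g] by simp

lemma one_coset: "\<one> <# H = H"
  using coset_eq coset_mult_one[OF subset] by simp

lemma mem_coset_iff: "g \<in> carrier G \<Longrightarrow> g <# H = H \<longleftrightarrow> g \<in> H"
  using coset_eq coset_join1[of H g] coset_join2[of g H] subgroup_axioms by auto

text \<open>
  The action of \<open>G/H\<close> on \<open>T\<^sup>H\<close>, with the same choice of representatives as in the induced data.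
\<close>

abbreviation \<gamma> where "\<gamma> A \<equiv> \<beta> (SOME g. g \<in> A)"

text \<open>
  Normality of \<open>H\<close> enters here: \<open>\<beta>\<^sub>l \<beta>\<^sub>g = \<beta>\<^sub>g \<beta>\<^sub>j\<close> with \<open>j = g\<inverse>lg \<in> H\<close>.
\<close>

lemma act_fixed_closed [simp]:
  assumes g: "g \<in> carrier G" and t: "t \<in> fixed"
  shows "\<beta> g t \<in> fixed"
proof (rule fixedI)
  fix l
  assume l: "l \<in> H"
  have "l \<otimes> g = g \<otimes> (inv g \<otimes> l \<otimes> g)"
    using l g by (simp flip: m_assoc)
  then have "\<beta> l (\<beta> g t) = \<beta> g (\<beta> (inv g \<otimes> l \<otimes> g) t)"
    using l g t by (simp add: act_act)
  then show "\<beta> l (\<beta> g t) = \<beta> g t"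
    using act_fixed[OF inv_op_closed1[OF g l] t] by simp
qed (use g t in simp)

lemma quotient_act:
  assumes g: "g \<in> carrier G" and t: "t \<in> fixed"
  shows "\<gamma> (g <# H) t = \<beta> g t"
proof -
  have "g \<in> g <# H"
    using g one_closed by (force simp: l_coset_def)
  then have "(SOME x. x \<in> g <# H) \<in> g <# H"
    by (rule someI)
  then obtain l where "l \<in> H" "(SOME x. x \<in> g <# H) = g \<otimes> l"
    by (auto simp: l_coset_def)
  then show ?thesis
    using g t act_act[of g l t] by simp
qed

lemma quotient_algebra_action: "algebra_action k (G Mod H) T_H \<gamma>"
proof (rule algebra_action.intro)
  show "group (G Mod H)"
    by (rule factorgroup_is_group)
  show "algebra k T_H"
    by (rule T_H_algebra)
  have one: "\<gamma> H t = t" if "t \<in> fixed" for t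
    using quotient_act[of \<one> t] that by (simp add: one_coset)
  show "algebra_action_axioms k (G Mod H) T_H \<gamma>"
  proof (rule algebra_action_axioms.intro)
    fix A B t
    assume AB: "A \<in> carrier (G Mod H)" "B \<in> carrier (G Mod H)" and "t \<in> carrier T_H"
    then have t: "t \<in> fixed" by simp
    obtain g where g: "g \<in> carrier G" "A = g <# H" using AB(1) by (rule quotient_cosetE)
    obtain g' where g': "g' \<in> carrier G" "B = g' <# H" using AB(2) by (rule quotient_cosetE)
    show "\<gamma> A (\<gamma> B t) = \<gamma> (A \<otimes>\<^bsub>G Mod H\<^esub> B) t"
      using g g' t by (simp add: quotient_act coset_mult act_act)
  qed (auto elim!: quotient_cosetE simp: quotient_act one act_add act_mult act_smult
      fixed_add fixed_mult fixed_smult)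
qed

lemma psi_e [simp]: "\<psi> e = f"
proof -
  have "\<one>\<^bsub>S\<^esub> \<in> carrier S_H"
    using subringE(3)[OF H.invariants_subring] by (simp add: S_H_carrier)
  moreover have "\<one>\<^bsub>T\<^esub> \<in> fixed"
    using subringE(3)[OF fixed_subring] .
  ultimately show ?thesis
    using psi_fixed_mult_e[of "\<one>\<^bsub>S\<^esub>" "\<one>\<^bsub>T\<^esub>"] by simp
qed

lemma inv_into_fixed_mult_e:
  assumes "t \<in> fixed"
  shows "inv_into (carrier S) \<iota> (t \<otimes>\<^bsub>T\<^esub> e) \<in> carrier S_H"
    and "\<iota> (inv_into (carrier S) \<iota> (t \<otimes>\<^bsub>T\<^esub> e)) = t \<otimes>\<^bsub>T\<^esub> e"
proof -
  obtain s where s: "s \<in> carrier S_H" "\<iota> s = t \<otimes>\<^bsub>T\<^esub> e"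
    using assms by (rule fixed_mult_e_preimage)
  have "inv_into (carrier S) \<iota> (t \<otimes>\<^bsub>T\<^esub> e) = s"
    using s emb_inj by (simp flip: s(2))
  then show "inv_into (carrier S) \<iota> (t \<otimes>\<^bsub>T\<^esub> e) \<in> carrier S_H"
    and "\<iota> (inv_into (carrier S) \<iota> (t \<otimes>\<^bsub>T\<^esub> e)) = t \<otimes>\<^bsub>T\<^esub> e"
    using s by simp_all
qed

abbreviation u' where "u' \<equiv> induced_unit S T \<beta> \<iota> h m"

abbreviation \<alpha>' where "\<alpha>' \<equiv> induced_map S T \<beta> \<iota> h m"

abbreviation D' where "D' \<equiv> induced_ideal G H S \<alpha> u T \<beta> \<iota> h m"

lemma induced_unit_closed: "g \<in> carrier G \<Longrightarrow> u' (g <# H) \<in> carrier S_H"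
  and emb_induced_unit: "g \<in> carrier G \<Longrightarrow> \<iota> (u' (g <# H)) = \<beta> g f \<otimes>\<^bsub>T\<^esub> e"
  using inv_into_fixed_mult_e[of "\<beta> g f"] by (simp_all add: induced_unit_def quotient_act)

lemma induced_map_closed:
    "\<lbrakk>g \<in> carrier G; x \<in> carrier S_H\<rbrakk> \<Longrightarrow> \<alpha>' (g <# H) x \<in> carrier S_H"
  and emb_induced_map:
    "\<lbrakk>g \<in> carrier G; x \<in> carrier S_H\<rbrakk> \<Longrightarrow> \<iota> (\<alpha>' (g <# H) x) = \<beta> g (\<psi> (\<iota> x)) \<otimes>\<^bsub>T\<^esub> e"
  using inv_into_fixed_mult_e[of "\<beta> g (\<psi> (\<iota> x))"] by (simp_all add: induced_map_def quotient_act)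

lemma induced_ideal_subset:
  assumes "g \<in> carrier G"
  shows "D' (g <# H) \<subseteq> carrier S_H"
proof -
  interpret S_H: algebra k S_H
    by (rule S_H_algebra)
  show ?thesis
    using induced_unit_closed[OF assms] S_H.m_closed
    by (auto simp: induced_ideal_def cgenideal_def simp del: S_H_simps)
qed

text \<open>
  The induced data are the restriction to \<open>T\<^sup>H f\<close> of the action of \<open>G/H\<close> on \<open>T\<^sup>H\<close>, with \<open>\<psi>\<^sub>H\<close> as
  embedding. Each equation for \<open>\<psi>\<^sub>H\<close> holds because both sides are elements of \<open>T\<^sup>H f\<close> with the same
  product with \<open>e\<close>.
\<close>

theorem quotient_idempotent_restriction:
  "idempotent_restriction k (G Mod H) T_H \<gamma> S_H D' \<alpha>' u' (\<lambda>s. \<psi> (\<iota> s))"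
proof (intro idempotent_restriction.intro quotient_algebra_action S_H_algebra
    idempotent_restriction_axioms.intro)
  interpret S_H: algebra k S_H
    by (rule S_H_algebra)
  have psiI: "\<psi> (\<iota> s) = t" if "s \<in> carrier S_H" "t \<in> fixed" "t \<otimes>\<^bsub>T\<^esub> f = t" "\<iota> s = t \<otimes>\<^bsub>T\<^esub> e" for s t
    using psi_fixed_mult_e[of s t] that by simp
  have psif: "\<psi> (\<iota> s) \<otimes>\<^bsub>T\<^esub> f = \<psi> (\<iota> s)" if "s \<in> carrier S_H" for s
    using that by (simp add: psi_f)
  show "nonunital_algebra_hom k S_H (carrier S_H) T_H (carrier T_H) (\<lambda>s. \<psi> (\<iota> s))"
    unfolding nonunital_algebra_hom_def
  proof (intro conjI ballI)
    show "(\<lambda>s. \<psi> (\<iota> s)) \<in> carrier S_H \<rightarrow> carrier T_H"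
      by (rule Pi_I) simp
  next
    fix s t
    assume st: "s \<in> carrier S_H" "t \<in> carrier S_H"
    then have cl: "s \<oplus>\<^bsub>S\<^esub> t \<in> carrier S_H" "s \<otimes>\<^bsub>S\<^esub> t \<in> carrier S_H"
      using S_H.a_closed[of s t] S_H.m_closed[of s t] by simp_all
    have "\<psi> (\<iota> (s \<oplus>\<^bsub>S\<^esub> t)) = \<psi> (\<iota> s) \<oplus>\<^bsub>T\<^esub> \<psi> (\<iota> t)"
      using st by (intro psiI cl fixed_add psi_fixed)
        (simp_all add: T.l_distr psif psi_mult_e emb_add)
    then show "\<psi> (\<iota> (s \<oplus>\<^bsub>S_H\<^esub> t)) = \<psi> (\<iota> s) \<oplus>\<^bsub>T_H\<^esub> \<psi> (\<iota> t)"
      by simp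
    have "\<psi> (\<iota> (s \<otimes>\<^bsub>S\<^esub> t)) = \<psi> (\<iota> s) \<otimes>\<^bsub>T\<^esub> \<psi> (\<iota> t)"
    proof (intro psiI cl fixed_mult psi_fixed st)
      have "\<iota> (s \<otimes>\<^bsub>S\<^esub> t) = (\<psi> (\<iota> s) \<otimes>\<^bsub>T\<^esub> e) \<otimes>\<^bsub>T\<^esub> (\<psi> (\<iota> t) \<otimes>\<^bsub>T\<^esub> e)"
        using st by (simp add: psi_mult_e emb_mult)
      also have "\<dots> = \<psi> (\<iota> s) \<otimes>\<^bsub>T\<^esub> \<psi> (\<iota> t) \<otimes>\<^bsub>T\<^esub> (e \<otimes>\<^bsub>T\<^esub> e)"
        using st by (simp add: T.m_ac del: emb_e emb_e_left H.emb_e H.emb_e_left)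
      finally show "\<iota> (s \<otimes>\<^bsub>S\<^esub> t) = \<psi> (\<iota> s) \<otimes>\<^bsub>T\<^esub> \<psi> (\<iota> t) \<otimes>\<^bsub>T\<^esub> e"
        by simp
    qed (use st in \<open>simp add: T.m_assoc psif\<close>)
    then show "\<psi> (\<iota> (s \<otimes>\<^bsub>S_H\<^esub> t)) = \<psi> (\<iota> s) \<otimes>\<^bsub>T_H\<^esub> \<psi> (\<iota> t)"
      by simp
  next
    fix c s
    assume cs: "c \<in> carrier k" "s \<in> carrier S_H"
    then have cl: "c \<odot>\<^bsub>S\<^esub> s \<in> carrier S_H"
      using S_H.smult_closed[of c s] by simp
    have "\<psi> (\<iota> (c \<odot>\<^bsub>S\<^esub> s)) = c \<odot>\<^bsub>T\<^esub> \<psi> (\<iota> s)"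
      using cs by (intro psiI cl fixed_smult psi_fixed)
        (simp_all add: T.smult_assoc2 psif psi_mult_e emb_smult)
    then show "\<psi> (\<iota> (c \<odot>\<^bsub>S_H\<^esub> s)) = c \<odot>\<^bsub>T_H\<^esub> \<psi> (\<iota> s)"
      by simp
  qed
  show "inj_on (\<lambda>s. \<psi> (\<iota> s)) (carrier S_H)"
  proof (rule inj_onI)
    fix s t
    assume st: "s \<in> carrier S_H" "t \<in> carrier S_H" "\<psi> (\<iota> s) = \<psi> (\<iota> t)"
    have "\<iota> s = \<psi> (\<iota> t) \<otimes>\<^bsub>T\<^esub> e"
      using psi_mult_e[OF st(1)] unfolding st(3) by (rule sym)
    also have "\<dots> = \<iota> t"
      by (rule psi_mult_e[OF st(2)])
    finally show "s = t"
      using emb_eq_iff[of s t] st(1,2) by simp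
  qed
  show "(\<lambda>s. \<psi> (\<iota> s)) ` carrier S_H = {t \<in> carrier T_H. t \<otimes>\<^bsub>T_H\<^esub> \<psi> (\<iota> \<one>\<^bsub>S_H\<^esub>) = t}"
  proof (intro equalityI subsetI)
    fix t
    assume "t \<in> {t \<in> carrier T_H. t \<otimes>\<^bsub>T_H\<^esub> \<psi> (\<iota> \<one>\<^bsub>S_H\<^esub>) = t}"
    then have t: "t \<in> fixed" "t \<otimes>\<^bsub>T\<^esub> f = t" by simp_all
    obtain s where "s \<in> carrier S_H" "\<iota> s = t \<otimes>\<^bsub>T\<^esub> e"
      using t(1) by (rule fixed_mult_e_preimage)
    then show "t \<in> (\<lambda>s. \<psi> (\<iota> s)) ` carrier S_H"
      using psiI[of s t] t by (intro image_eqI[of _ _ s]) simp_all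
  qed (auto simp: psif)
next
  fix A
  assume "A \<in> carrier (G Mod H)"
  then obtain g where g: "g \<in> carrier G" "A = g <# H"
    by (rule quotient_cosetE)
  show "u' A \<in> carrier S_H"
    using g induced_unit_closed by simp
  show "D' A = PIdl\<^bsub>S_H\<^esub> (u' A)"
    by (simp add: induced_ideal_def)
  have "\<psi> (\<iota> (u' (g <# H))) = \<beta> g f \<otimes>\<^bsub>T\<^esub> f"
    using g by (intro psi_fixed_mult_e induced_unit_closed emb_induced_unit) simp_all
  then show "\<psi> (\<iota> (u' A)) = \<gamma> A (\<psi> (\<iota> \<one>\<^bsub>S_H\<^esub>)) \<otimes>\<^bsub>T_H\<^esub> \<psi> (\<iota> \<one>\<^bsub>S_H\<^esub>)"
    using g by (simp add: quotient_act)
  fix x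
  assume "x \<in> D' (inv\<^bsub>G Mod H\<^esub> A)"
  then have x: "x \<in> carrier S_H"
    using induced_ideal_subset[of "inv g"] g by (auto simp: coset_inv)
  show "\<alpha>' A x \<in> carrier S_H"
    using g x induced_map_closed by simp
  have "\<psi> (\<iota> (\<alpha>' (g <# H) x)) = \<beta> g (\<psi> (\<iota> x)) \<otimes>\<^bsub>T\<^esub> f"
    using g x by (intro psi_fixed_mult_e induced_map_closed emb_induced_map) simp_all
  then show "\<psi> (\<iota> (\<alpha>' A x)) = \<gamma> A (\<psi> (\<iota> x)) \<otimes>\<^bsub>T_H\<^esub> \<psi> (\<iota> \<one>\<^bsub>S_H\<^esub>)"
    using g x by (simp add: quotient_act)
qed

text \<open>
  By the descriptions of invariants for the two restrictions, \<open>s \<in> S\<^bsup>\<alpha>\<^sub>H\<^esup>\<close> with \<open>a = \<psi>\<^sub>H(s)\<close> has to be shown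
  to satisfy \<open>\<beta>\<^sub>g(a) f = a \<beta>\<^sub>g(f)\<close> for all \<open>g\<close> if and only if \<open>\<beta>\<^sub>g(s) e = s \<beta>\<^sub>g(e)\<close> for all \<open>g\<close>. The
  first equation multiplied by \<open>e \<beta>\<^sub>g(e)\<close> is the second. Conversely both sides of the first lie in
  \<open>T\<^sup>H f\<close>, so they may be compared after multiplication by \<open>e\<close>, and \<open>\<beta>\<^sub>g(a) e = s \<beta>\<^sub>g(f)\<close> is
  \<open>psi_mult_act\<close> for \<open>g\<inverse>\<close>, translated by \<open>\<beta>\<^sub>g\<close>.
\<close>

theorem quotient_invariants: "invariants (G Mod H) S_H \<alpha>' u' = invariants G S \<alpha> u"
proof -
  interpret Q: idempotent_restriction k "G Mod H" T_H \<gamma> S_H D' \<alpha>' u' "\<lambda>s. \<psi> (\<iota> s)"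
    by (rule quotient_idempotent_restriction)
  have Q_iff: "s \<in> invariants (G Mod H) S_H \<alpha>' u' \<longleftrightarrow> s \<in> carrier S_H \<and>
      (\<forall>g\<in>carrier G. \<beta> g (\<psi> (\<iota> s)) \<otimes>\<^bsub>T\<^esub> f = \<psi> (\<iota> s) \<otimes>\<^bsub>T\<^esub> \<beta> g f)" for s
  proof -
    show ?thesis
      unfolding Q.invariants_iff ball_simps quotient_carrier
      by (intro conj_cong ball_cong refl) (simp_all add: quotient_act)
  qed
  show ?thesis
  proof (intro equalityI subsetI)
    fix s
    assume "s \<in> invariants (G Mod H) S_H \<alpha>' u'"
    then have s: "s \<in> carrier S_H"
      and inv: "\<And>g. g \<in> carrier G \<Longrightarrow> \<beta> g (\<psi> (\<iota> s)) \<otimes>\<^bsub>T\<^esub> f = \<psi> (\<iota> s) \<otimes>\<^bsub>T\<^esub> \<beta> g f"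
      unfolding Q_iff by auto
    have "\<beta> g (\<iota> s) \<otimes>\<^bsub>T\<^esub> e = \<iota> s \<otimes>\<^bsub>T\<^esub> \<beta> g e" if g: "g \<in> carrier G" for g
    proof -
      let ?a = "\<psi> (\<iota> s)"
      have a: "?a \<in> carrier T" using s by simp
      have "\<beta> g (\<iota> s) = \<beta> g (?a \<otimes>\<^bsub>T\<^esub> e)"
        using psi_mult_e[OF s] by simp
      then have "\<beta> g (\<iota> s) \<otimes>\<^bsub>T\<^esub> e = \<beta> g ?a \<otimes>\<^bsub>T\<^esub> \<beta> g e \<otimes>\<^bsub>T\<^esub> (f \<otimes>\<^bsub>T\<^esub> e)"
        using a g by (simp add: act_mult)
      also have "\<dots> = \<beta> g ?a \<otimes>\<^bsub>T\<^esub> f \<otimes>\<^bsub>T\<^esub> \<beta> g e \<otimes>\<^bsub>T\<^esub> e"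
        using a g by (simp add: T.m_ac del: f_e e_f)
      also have "\<dots> = ?a \<otimes>\<^bsub>T\<^esub> \<beta> g (f \<otimes>\<^bsub>T\<^esub> e) \<otimes>\<^bsub>T\<^esub> e"
        unfolding inv[OF g] using a g by (simp add: act_mult T.m_assoc del: f_e)
      also have "\<dots> = ?a \<otimes>\<^bsub>T\<^esub> e \<otimes>\<^bsub>T\<^esub> \<beta> g e"
        using a g by (simp add: T.m_assoc T.m_comm[of e])
      finally show ?thesis
        using psi_mult_e[OF s] by simp
    qed
    then show "s \<in> invariants G S \<alpha> u"
      using s unfolding invariants_iff by simp
  next
    fix s
    assume s: "s \<in> invariants G S \<alpha> u"
    then have sS: "s \<in> carrier S" and sH: "s \<in> carrier S_H"
      unfolding S_H_carrier_iff invariants_iff by auto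
    have "\<beta> g (\<psi> (\<iota> s)) \<otimes>\<^bsub>T\<^esub> f = \<psi> (\<iota> s) \<otimes>\<^bsub>T\<^esub> \<beta> g f" if g: "g \<in> carrier G" for g
    proof (rule fixed_eqI)
      let ?a = "\<psi> (\<iota> s)"
      have a: "?a \<in> fixed" using sH by simp
      have af: "?a \<otimes>\<^bsub>T\<^esub> f = ?a" using sH by (simp add: psi_f)
      show "\<beta> g ?a \<otimes>\<^bsub>T\<^esub> f \<in> fixed" "?a \<otimes>\<^bsub>T\<^esub> \<beta> g f \<in> fixed"
        using a g by (simp_all add: fixed_mult)
      show "\<beta> g ?a \<otimes>\<^bsub>T\<^esub> f \<otimes>\<^bsub>T\<^esub> f = \<beta> g ?a \<otimes>\<^bsub>T\<^esub> f"
        using a g by (simp add: T.m_assoc)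
      have "?a \<otimes>\<^bsub>T\<^esub> \<beta> g f \<otimes>\<^bsub>T\<^esub> f = ?a \<otimes>\<^bsub>T\<^esub> f \<otimes>\<^bsub>T\<^esub> \<beta> g f"
        using sH g by (simp add: T.m_ac)
      then show "?a \<otimes>\<^bsub>T\<^esub> \<beta> g f \<otimes>\<^bsub>T\<^esub> f = ?a \<otimes>\<^bsub>T\<^esub> \<beta> g f"
        unfolding af .
      have "?a \<otimes>\<^bsub>T\<^esub> \<beta> (inv g) e = \<beta> (inv g) (\<iota> s) \<otimes>\<^bsub>T\<^esub> f"
        using g sS invariant_act_comm[OF s] by (intro psi_mult_act) auto
      then have "\<beta> g (?a \<otimes>\<^bsub>T\<^esub> \<beta> (inv g) e) = \<beta> g (\<beta> (inv g) (\<iota> s) \<otimes>\<^bsub>T\<^esub> f)"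
        by simp
      then have *: "\<beta> g ?a \<otimes>\<^bsub>T\<^esub> e = \<iota> s \<otimes>\<^bsub>T\<^esub> \<beta> g f"
        using g a sS by (simp add: act_mult)
      have "\<beta> g ?a \<otimes>\<^bsub>T\<^esub> f \<otimes>\<^bsub>T\<^esub> e = \<beta> g ?a \<otimes>\<^bsub>T\<^esub> e"
        using g a by (simp add: T.m_assoc)
      also have "\<dots> = ?a \<otimes>\<^bsub>T\<^esub> e \<otimes>\<^bsub>T\<^esub> \<beta> g f"
        using * psi_mult_e[OF sH] by simp
      also have "\<dots> = ?a \<otimes>\<^bsub>T\<^esub> \<beta> g f \<otimes>\<^bsub>T\<^esub> e"
        using g a by (simp add: T.m_assoc T.m_comm[of e])
      finally show "\<beta> g ?a \<otimes>\<^bsub>T\<^esub> f \<otimes>\<^bsub>T\<^esub> e = ?a \<otimes>\<^bsub>T\<^esub> \<beta> g f \<otimes>\<^bsub>T\<^esub> e" .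
    qed
    then show "s \<in> invariants (G Mod H) S_H \<alpha>' u'"
      using sH unfolding Q_iff by simp
  qed
qed

end


section \<open>Galois coordinates for the quotient\<close>

context quotient_restriction
begin

lemma finite_H: "finite H"
  using finite_group finite_subset[OF subset] by blast

definition tr :: "'b \<Rightarrow> 'b" where
  "tr t = (\<Oplus>\<^bsub>T\<^esub>l\<in>H. \<beta> l t)"

lemma tr_closed [simp]: "t \<in> carrier T \<Longrightarrow> tr t \<in> carrier T"
  unfolding tr_def by (intro T.M.finsum_closed) auto

lemma tr_fixed [simp]:
  assumes t: "t \<in> carrier T"
  shows "tr t \<in> fixed"
proof (rule fixedI)
  fix l
  assume l: "l \<in> H"
  have bij: "inj_on ((\<otimes>) l) H" "(\<otimes>) l ` H = H"
  proof -
    show "inj_on ((\<otimes>) l) H"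
      using l by (auto intro!: inj_onI)
    show "(\<otimes>) l ` H = H"
    proof (intro equalityI subsetI)
      fix j
      assume j: "j \<in> H"
      have "j = l \<otimes> (inv l \<otimes> j)"
        using l j by (simp flip: m_assoc)
      then show "j \<in> (\<otimes>) l ` H"
        using l j by (intro image_eqI[of _ _ "inv l \<otimes> j"]) simp_all
    qed (use l in auto)
  qed
  have "\<beta> l (tr t) = (\<Oplus>\<^bsub>T\<^esub>j\<in>H. \<beta> l (\<beta> j t))"
    unfolding tr_def using l t by (intro act_finsum finite_H) auto
  also have "\<dots> = (\<Oplus>\<^bsub>T\<^esub>j\<in>H. \<beta> (l \<otimes> j) t)"
    using l t by (intro T.M.finsum_cong') (auto simp: act_act)
  also have "\<dots> = (\<Oplus>\<^bsub>T\<^esub>j\<in>(\<otimes>) l ` H. \<beta> j t)"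
    using l t bij by (intro T.M.finsum_reindex[symmetric]) auto
  finally show "\<beta> l (tr t) = tr t"
    unfolding bij(2) tr_def .
qed (use t in simp)

lemma tr_mult_fixed:
  assumes "t \<in> carrier T" and "a \<in> fixed"
  shows "tr (t \<otimes>\<^bsub>T\<^esub> a) = tr t \<otimes>\<^bsub>T\<^esub> a"
proof -
  have "tr t \<otimes>\<^bsub>T\<^esub> a = (\<Oplus>\<^bsub>T\<^esub>l\<in>H. \<beta> l t \<otimes>\<^bsub>T\<^esub> a)"
    unfolding tr_def using assms by (intro T.finsum_ldistr finite_H) auto
  also have "\<dots> = tr (t \<otimes>\<^bsub>T\<^esub> a)"
    unfolding tr_def using assms by (intro T.M.finsum_cong') (auto simp: act_mult)
  finally show ?thesis by simp
qed

lemma tr_add: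
  assumes "s \<in> carrier T" and "t \<in> carrier T"
  shows "tr (s \<oplus>\<^bsub>T\<^esub> t) = tr s \<oplus>\<^bsub>T\<^esub> tr t"
proof -
  have "tr (s \<oplus>\<^bsub>T\<^esub> t) = (\<Oplus>\<^bsub>T\<^esub>l\<in>H. \<beta> l s \<oplus>\<^bsub>T\<^esub> \<beta> l t)"
    unfolding tr_def using assms by (intro T.M.finsum_cong') (auto simp: act_add)
  also have "\<dots> = tr s \<oplus>\<^bsub>T\<^esub> tr t"
    unfolding tr_def using assms by (intro T.M.finsum_addf) auto
  finally show ?thesis .
qed

lemma tr_zero [simp]: "tr \<zero>\<^bsub>T\<^esub> = \<zero>\<^bsub>T\<^esub>"
proof -
  have "tr \<zero>\<^bsub>T\<^esub> = (\<Oplus>\<^bsub>T\<^esub>l\<in>H. \<zero>\<^bsub>T\<^esub>)"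
    unfolding tr_def by (intro T.M.finsum_cong') auto
  then show ?thesis by simp
qed

lemma tr_a_inv:
  assumes "t \<in> carrier T"
  shows "tr (\<ominus>\<^bsub>T\<^esub> t) = \<ominus>\<^bsub>T\<^esub> tr t"
proof -
  have "tr (\<ominus>\<^bsub>T\<^esub> t) \<oplus>\<^bsub>T\<^esub> tr t = \<zero>\<^bsub>T\<^esub>"
    using tr_add[of "\<ominus>\<^bsub>T\<^esub> t" t] assms by (simp add: T.M.l_neg)
  then show ?thesis
    using assms by (simp add: T.M.minus_equality)
qed

lemma tr_finsum:
  assumes "finite I" and "F \<in> I \<rightarrow> carrier T"
  shows "tr (\<Oplus>\<^bsub>T\<^esub>i\<in>I. F i) = (\<Oplus>\<^bsub>T\<^esub>i\<in>I. tr (F i))"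
  using assms by (induction I) (auto simp: tr_add Pi_iff)

lemma tr_emb_f:
  assumes "s \<in> carrier S"
  shows "tr (\<iota> s) \<otimes>\<^bsub>T\<^esub> f = tr (\<iota> s)"
proof -
  have "tr (\<iota> s) \<otimes>\<^bsub>T\<^esub> f = tr (\<iota> s \<otimes>\<^bsub>T\<^esub> f)"
    using assms by (simp add: tr_mult_fixed)
  also have "\<iota> s \<otimes>\<^bsub>T\<^esub> f = \<iota> s \<otimes>\<^bsub>T\<^esub> (e \<otimes>\<^bsub>T\<^esub> f)"
    using assms emb_mult_e[of s f] by (simp del: e_f)
  also have "\<dots> = \<iota> s"
    using assms by simp
  finally show ?thesis .
qed

lemma emb_mult_closed:
  assumes "s \<in> carrier S" and "t \<in> carrier T"
  obtains z where "z \<in> carrier S" and "\<iota> z = \<iota> s \<otimes>\<^bsub>T\<^esub> t"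
proof (rule preimage)
  show "\<iota> s \<otimes>\<^bsub>T\<^esub> t \<otimes>\<^bsub>T\<^esub> e = \<iota> s \<otimes>\<^bsub>T\<^esub> t"
    using assms by (simp add: T.m_assoc T.m_comm[of t])
qed (use assms that in auto)

text \<open>
  Expanding the trace, the coefficient of \<open>\<beta>\<^bsub>gl\<^esub>(t)\<close> is the Galois sum for \<open>gl\<close>. It vanishes unless
  \<open>l = g\<inverse>\<close>, and this \<open>l\<close> occurs in the sum over \<open>H\<close> only if \<open>g \<in> H\<close>.
\<close>

lemma galois_sum_tr:
  fixes n :: nat and x y :: "nat \<Rightarrow> 'a"
  assumes xy: "\<And>i. i \<in> {1..n} \<Longrightarrow> x i \<in> carrier S \<and> y i \<in> carrier S"
    and gal: "\<And>g. g \<in> carrier G \<Longrightarrow> (\<Oplus>\<^bsub>T\<^esub>i\<in>{1..n}. \<iota> (x i) \<otimes>\<^bsub>T\<^esub> \<beta> g (\<iota> (y i))) =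
      (if g = \<one> then e else \<zero>\<^bsub>T\<^esub>)"
    and g: "g \<in> carrier G" and t: "t \<in> carrier T"
  shows "(\<Oplus>\<^bsub>T\<^esub>i\<in>{1..n}. \<iota> (x i) \<otimes>\<^bsub>T\<^esub> \<beta> g (tr (\<iota> (y i) \<otimes>\<^bsub>T\<^esub> t))) =
    (if g \<in> H then e \<otimes>\<^bsub>T\<^esub> t else \<zero>\<^bsub>T\<^esub>)"
proof -
  let ?F = "\<lambda>i l. \<iota> (x i) \<otimes>\<^bsub>T\<^esub> \<beta> (g \<otimes> l) (\<iota> (y i)) \<otimes>\<^bsub>T\<^esub> \<beta> (g \<otimes> l) t"
  have F: "?F i l \<in> carrier T" if "i \<in> {1..n}" "l \<in> H" for i l
    using xy[OF that(1)] that(2) g t by simp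
  have "\<iota> (x i) \<otimes>\<^bsub>T\<^esub> \<beta> g (tr (\<iota> (y i) \<otimes>\<^bsub>T\<^esub> t)) = (\<Oplus>\<^bsub>T\<^esub>l\<in>H. ?F i l)" if i: "i \<in> {1..n}" for i
  proof -
    have cl: "x i \<in> carrier S" "y i \<in> carrier S" using xy[OF i] by auto
    have "\<beta> g (tr (\<iota> (y i) \<otimes>\<^bsub>T\<^esub> t)) = (\<Oplus>\<^bsub>T\<^esub>l\<in>H. \<beta> g (\<beta> l (\<iota> (y i) \<otimes>\<^bsub>T\<^esub> t)))"
      unfolding tr_def using cl g t by (intro act_finsum finite_H) auto
    then have "\<iota> (x i) \<otimes>\<^bsub>T\<^esub> \<beta> g (tr (\<iota> (y i) \<otimes>\<^bsub>T\<^esub> t)) =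
        (\<Oplus>\<^bsub>T\<^esub>l\<in>H. \<iota> (x i) \<otimes>\<^bsub>T\<^esub> \<beta> g (\<beta> l (\<iota> (y i) \<otimes>\<^bsub>T\<^esub> t)))"
      using cl g t finite_H by (simp add: T.finsum_rdistr Pi_iff)
    also have "\<dots> = (\<Oplus>\<^bsub>T\<^esub>l\<in>H. ?F i l)"
      using cl g t by (intro T.M.finsum_cong') (auto simp: act_mult act_act T.m_assoc)
    finally show ?thesis .
  qed
  then have "(\<Oplus>\<^bsub>T\<^esub>i\<in>{1..n}. \<iota> (x i) \<otimes>\<^bsub>T\<^esub> \<beta> g (tr (\<iota> (y i) \<otimes>\<^bsub>T\<^esub> t))) =
      (\<Oplus>\<^bsub>T\<^esub>i\<in>{1..n}. \<Oplus>\<^bsub>T\<^esub>l\<in>H. ?F i l)"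
    using F by (intro T.M.finsum_cong') auto
  also have "\<dots> = (\<Oplus>\<^bsub>T\<^esub>l\<in>H. \<Oplus>\<^bsub>T\<^esub>i\<in>{1..n}. ?F i l)"
    using F finite_H by (intro T.M.finsum_finsum_swap) auto
  also have "\<dots> = (\<Oplus>\<^bsub>T\<^esub>l\<in>H. if inv g = l then e \<otimes>\<^bsub>T\<^esub> t else \<zero>\<^bsub>T\<^esub>)"
  proof (intro T.M.finsum_cong')
    fix l
    assume l: "l \<in> H"
    have "(\<Oplus>\<^bsub>T\<^esub>i\<in>{1..n}. ?F i l) =
        (\<Oplus>\<^bsub>T\<^esub>i\<in>{1..n}. \<iota> (x i) \<otimes>\<^bsub>T\<^esub> \<beta> (g \<otimes> l) (\<iota> (y i))) \<otimes>\<^bsub>T\<^esub> \<beta> (g \<otimes> l) t"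
      using xy l g t by (intro T.finsum_ldistr[symmetric]) auto
    also have "\<dots> = (if g \<otimes> l = \<one> then e \<otimes>\<^bsub>T\<^esub> t else \<zero>\<^bsub>T\<^esub>)"
      using gal[of "g \<otimes> l"] l g t by simp
    also have "g \<otimes> l = \<one> \<longleftrightarrow> inv g = l"
      using l g inv_equality[of l g] inv_comm[of g l] by auto
    finally show "(\<Oplus>\<^bsub>T\<^esub>i\<in>{1..n}. ?F i l) = (if inv g = l then e \<otimes>\<^bsub>T\<^esub> t else \<zero>\<^bsub>T\<^esub>)" .
  qed (use t in auto)
  also have "\<dots> = (if g \<in> H then e \<otimes>\<^bsub>T\<^esub> t else \<zero>\<^bsub>T\<^esub>)"
  proof (cases "g \<in> H")
    case True
    then show ?thesis
      using T.M.finsum_singleton[of "inv g" H "\<lambda>_. e \<otimes>\<^bsub>T\<^esub> t"] finite_H t by simp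
  next
    case False
    then have "inv g \<noteq> l" if "l \<in> H" for l
      using that g m_inv_closed[of l] inv_inv by metis
    then have "(\<Oplus>\<^bsub>T\<^esub>l\<in>H. if inv g = l then e \<otimes>\<^bsub>T\<^esub> t else \<zero>\<^bsub>T\<^esub>) = (\<Oplus>\<^bsub>T\<^esub>l\<in>H. \<zero>\<^bsub>T\<^esub>)"
      using t by (intro T.M.finsum_cong') auto
    then show ?thesis using False by simp
  qed
  finally show ?thesis .
qed

text \<open>
  The \<open>x\<^sub>i\<close> generate \<open>S\<close> with coefficients that are traces of elements of \<open>S\<close>:
  \<open>t = \<Sum> tr(y\<^sub>i t) x\<^sub>i\<close> for \<open>t \<in> S\<close>. The image is closed under products since
  \<open>tr(s) tr(t) = tr(s tr(t))\<close> and \<open>S\<close> is an ideal, so Nakayama's lemma applies.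
\<close>

lemma exists_trace_f:
  fixes n :: nat and x y :: "nat \<Rightarrow> 'a"
  assumes xy: "\<And>i. i \<in> {1..n} \<Longrightarrow> x i \<in> carrier S \<and> y i \<in> carrier S"
    and gal: "\<And>g. g \<in> carrier G \<Longrightarrow> (\<Oplus>\<^bsub>T\<^esub>i\<in>{1..n}. \<iota> (x i) \<otimes>\<^bsub>T\<^esub> \<beta> g (\<iota> (y i))) =
      (if g = \<one> then e else \<zero>\<^bsub>T\<^esub>)"
  obtains c where "c \<in> carrier S" and "tr (\<iota> c) = f"
proof -
  let ?I = "(\<lambda>s. tr (\<iota> s)) ` carrier S"
  let ?js = "[1..<Suc n]"
  let ?xs = "map (\<lambda>i. \<iota> (x i)) ?js"
  have js: "set ?js = {1..n}" by auto
  have one: "\<one> \<in> carrier G" by simp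
  have I: "?I \<subseteq> carrier T" by auto
  have "\<exists>r\<in>?I. \<forall>t\<in>set ?xs. r \<otimes>\<^bsub>T\<^esub> t = t"
  proof (rule T.nakayama)
    show "?I \<subseteq> carrier T" by fact
    show "\<zero>\<^bsub>T\<^esub> \<in> ?I"
      by (rule image_eqI[of _ _ "\<zero>\<^bsub>S\<^esub>"]) simp_all
    show "\<ominus>\<^bsub>T\<^esub> a \<in> ?I" if a: "a \<in> ?I" for a
    proof -
      obtain s where "s \<in> carrier S" "a = tr (\<iota> s)" using a by auto
      then show ?thesis
        by (intro image_eqI[of _ _ "\<ominus>\<^bsub>S\<^esub> s"]) (simp_all add: emb_a_inv tr_a_inv)
    qed
    fix a b
    assume "a \<in> ?I" "b \<in> ?I"
    then obtain s t where s: "s \<in> carrier S" "a = tr (\<iota> s)" and t: "t \<in> carrier S" "b = tr (\<iota> t)"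
      by auto
    show "a \<oplus>\<^bsub>T\<^esub> b \<in> ?I"
      using s t by (intro image_eqI[of _ _ "s \<oplus>\<^bsub>S\<^esub> t"]) (simp_all add: emb_add tr_add)
    obtain z where "z \<in> carrier S" "\<iota> z = \<iota> s \<otimes>\<^bsub>T\<^esub> tr (\<iota> t)"
      using emb_mult_closed[OF s(1) tr_closed[OF emb_closed[OF t(1)]]] .
    then show "a \<otimes>\<^bsub>T\<^esub> b \<in> ?I"
      using s t by (intro image_eqI[of _ _ z]) (simp_all add: tr_mult_fixed)
  next
    show "set ?xs \<subseteq> carrier T"
      using xy by auto
  next
    fix t
    assume "t \<in> set ?xs"
    then obtain j where j: "j \<in> {1..n}" "t = \<iota> (x j)"
      unfolding set_map js by blast
    have mem: "tr (\<iota> (y i) \<otimes>\<^bsub>T\<^esub> t) \<in> ?I" if i: "i \<in> {1..n}" for i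
    proof -
      have "y i \<otimes>\<^bsub>S\<^esub> x j \<in> carrier S" using xy[OF i] xy[OF j(1)] by simp
      then show ?thesis
        using xy[OF i] xy[OF j(1)] j(2) by (intro image_eqI[of _ _ "y i \<otimes>\<^bsub>S\<^esub> x j"]) (simp_all add: emb_mult)
    qed
    have tT: "t \<in> carrier T" using j xy by auto
    have "(\<Oplus>\<^bsub>T\<^esub>i\<in>{1..n}. tr (\<iota> (y i) \<otimes>\<^bsub>T\<^esub> t) \<otimes>\<^bsub>T\<^esub> \<iota> (x i)) =
        (\<Oplus>\<^bsub>T\<^esub>i\<in>{1..n}. \<iota> (x i) \<otimes>\<^bsub>T\<^esub> \<beta> \<one> (tr (\<iota> (y i) \<otimes>\<^bsub>T\<^esub> t)))"
      using xy tT by (intro T.M.finsum_cong') (auto simp: T.m_comm)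
    also have "\<dots> = t"
      using galois_sum_tr[OF xy gal one tT] j xy[of j] by simp
    finally have "t = (\<Oplus>\<^bsub>T\<^esub>i\<in>set ?js. tr (\<iota> (y i) \<otimes>\<^bsub>T\<^esub> t) \<otimes>\<^bsub>T\<^esub> \<iota> (x i))"
      unfolding js by simp
    also have "\<dots> \<in> combinations T ?I ?xs"
      using mem xy by (intro T.finsum_in_combinations I) auto
    finally show "t \<in> combinations T ?I ?xs" .
  qed
  then obtain c where c: "c \<in> carrier S" and c_fixes: "\<And>i. i \<in> {1..n} \<Longrightarrow> tr (\<iota> c) \<otimes>\<^bsub>T\<^esub> \<iota> (x i) = \<iota> (x i)"
    unfolding set_map js by auto
  have e_sum: "(\<Oplus>\<^bsub>T\<^esub>i\<in>{1..n}. \<iota> (x i) \<otimes>\<^bsub>T\<^esub> \<beta> \<one> (\<iota> (y i))) = e"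
    using gal[OF one] by simp
  have "tr (\<iota> c) \<otimes>\<^bsub>T\<^esub> e = (\<Oplus>\<^bsub>T\<^esub>i\<in>{1..n}. tr (\<iota> c) \<otimes>\<^bsub>T\<^esub> (\<iota> (x i) \<otimes>\<^bsub>T\<^esub> \<beta> \<one> (\<iota> (y i))))"
    unfolding e_sum[symmetric] using c xy by (intro T.finsum_rdistr) auto
  also have "\<dots> = (\<Oplus>\<^bsub>T\<^esub>i\<in>{1..n}. \<iota> (x i) \<otimes>\<^bsub>T\<^esub> \<beta> \<one> (\<iota> (y i)))"
    using c xy c_fixes by (intro T.M.finsum_cong') (auto simp flip: T.m_assoc)
  finally have "tr (\<iota> c) \<otimes>\<^bsub>T\<^esub> e = e"
    unfolding e_sum .
  then have eq: "tr (\<iota> c) \<otimes>\<^bsub>T\<^esub> e = f \<otimes>\<^bsub>T\<^esub> e"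
    by simp
  have "tr (\<iota> c) = f"
    by (rule fixed_eqI[OF _ _ _ _ eq]) (use c in \<open>simp_all add: tr_emb_f\<close>)
  with c show thesis by (rule that)
qed

text \<open>
  The new coordinates are \<open>tr(c x\<^sub>i)\<close> and \<open>tr(y\<^sub>i)\<close>, read in \<open>S\<^bsup>\<alpha>\<^sub>H\<^esup>\<close>. As \<open>\<beta>\<^sub>g(tr(y\<^sub>i)) \<in> T\<^sup>H\<close>, the trace can be
  pulled out: \<open>\<Sum> tr(c x\<^sub>i) \<beta>\<^sub>g(tr(y\<^sub>i)) = tr(c \<Sum> x\<^sub>i \<beta>\<^sub>g(tr(y\<^sub>i)))\<close>, which is \<open>tr(c) = f\<close> or \<open>0\<close>.
\<close>

theorem quotient_galois_coordinates:
  fixes n :: nat and x y :: "nat \<Rightarrow> 'a"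
  assumes xy: "\<And>i. i \<in> {1..n} \<Longrightarrow> x i \<in> carrier S \<and> y i \<in> carrier S"
    and gal: "\<And>g. g \<in> carrier G \<Longrightarrow> (\<Oplus>\<^bsub>T\<^esub>i\<in>{1..n}. \<iota> (x i) \<otimes>\<^bsub>T\<^esub> \<beta> g (\<iota> (y i))) =
      (if g = \<one> then e else \<zero>\<^bsub>T\<^esub>)"
  obtains x' y' where "\<And>i. i \<in> {1..n} \<Longrightarrow> x' i \<in> carrier S_H \<and> y' i \<in> carrier S_H"
    and "\<And>g. g \<in> carrier G \<Longrightarrow> (\<Oplus>\<^bsub>T\<^esub>i\<in>{1..n}. \<psi> (\<iota> (x' i)) \<otimes>\<^bsub>T\<^esub> \<beta> g (\<psi> (\<iota> (y' i)))) =
      (if g \<in> H then f else \<zero>\<^bsub>T\<^esub>)"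
proof -
  obtain c where c: "c \<in> carrier S" "tr (\<iota> c) = f"
    using xy gal by (rule exists_trace_f)
  have pull: "\<exists>s'\<in>carrier S_H. \<psi> (\<iota> s') = tr (\<iota> s)" if s: "s \<in> carrier S" for s
  proof -
    have "tr (\<iota> s) \<in> fixed"
      using s by simp
    then obtain s' where s': "s' \<in> carrier S_H" "\<iota> s' = tr (\<iota> s) \<otimes>\<^bsub>T\<^esub> e"
      by (rule fixed_mult_e_preimage)
    then have "\<psi> (\<iota> s') = tr (\<iota> s) \<otimes>\<^bsub>T\<^esub> f"
      using s by (intro psi_fixed_mult_e) simp_all
    then show ?thesis
      using s'(1) tr_emb_f[OF s] by auto
  qed
  then obtain P where P: "\<And>s. s \<in> carrier S \<Longrightarrow> P s \<in> carrier S_H \<and> \<psi> (\<iota> (P s)) = tr (\<iota> s)"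
    by metis
  let ?x = "\<lambda>i. P (c \<otimes>\<^bsub>S\<^esub> x i)" and ?y = "\<lambda>i. P (y i)"
  have "(\<Oplus>\<^bsub>T\<^esub>i\<in>{1..n}. \<psi> (\<iota> (?x i)) \<otimes>\<^bsub>T\<^esub> \<beta> g (\<psi> (\<iota> (?y i)))) =
      (if g \<in> H then f else \<zero>\<^bsub>T\<^esub>)" if g: "g \<in> carrier G" for g
  proof -
    let ?R = "\<lambda>i. \<iota> (x i) \<otimes>\<^bsub>T\<^esub> \<beta> g (tr (\<iota> (y i) \<otimes>\<^bsub>T\<^esub> \<one>\<^bsub>T\<^esub>))"
    have R: "?R i \<in> carrier T" if "i \<in> {1..n}" for i
      using xy[OF that] g by simp
    have "\<psi> (\<iota> (?x i)) \<otimes>\<^bsub>T\<^esub> \<beta> g (\<psi> (\<iota> (?y i))) = tr (\<iota> c \<otimes>\<^bsub>T\<^esub> ?R i)" if i: "i \<in> {1..n}" for i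
    proof -
      have cl: "x i \<in> carrier S" "y i \<in> carrier S" using xy[OF i] by auto
      have "\<psi> (\<iota> (?x i)) \<otimes>\<^bsub>T\<^esub> \<beta> g (\<psi> (\<iota> (?y i))) = tr (\<iota> (c \<otimes>\<^bsub>S\<^esub> x i)) \<otimes>\<^bsub>T\<^esub> \<beta> g (tr (\<iota> (y i)))"
        using P[of "c \<otimes>\<^bsub>S\<^esub> x i"] P[of "y i"] cl c by simp
      also have "\<dots> = tr (\<iota> (c \<otimes>\<^bsub>S\<^esub> x i) \<otimes>\<^bsub>T\<^esub> \<beta> g (tr (\<iota> (y i))))"
        using cl c g by (intro tr_mult_fixed[symmetric]) simp_all
      also have "\<iota> (c \<otimes>\<^bsub>S\<^esub> x i) \<otimes>\<^bsub>T\<^esub> \<beta> g (tr (\<iota> (y i))) = \<iota> c \<otimes>\<^bsub>T\<^esub> ?R i"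
        using cl c g by (simp add: emb_mult T.m_assoc)
      finally show ?thesis .
    qed
    then have "(\<Oplus>\<^bsub>T\<^esub>i\<in>{1..n}. \<psi> (\<iota> (?x i)) \<otimes>\<^bsub>T\<^esub> \<beta> g (\<psi> (\<iota> (?y i)))) =
        (\<Oplus>\<^bsub>T\<^esub>i\<in>{1..n}. tr (\<iota> c \<otimes>\<^bsub>T\<^esub> ?R i))"
      using R c by (intro T.M.finsum_cong') auto
    also have "\<dots> = tr (\<Oplus>\<^bsub>T\<^esub>i\<in>{1..n}. \<iota> c \<otimes>\<^bsub>T\<^esub> ?R i)"
      using R c by (intro tr_finsum[symmetric]) auto
    also have "(\<Oplus>\<^bsub>T\<^esub>i\<in>{1..n}. \<iota> c \<otimes>\<^bsub>T\<^esub> ?R i) = \<iota> c \<otimes>\<^bsub>T\<^esub> (\<Oplus>\<^bsub>T\<^esub>i\<in>{1..n}. ?R i)"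
      using R c by (intro T.finsum_rdistr[symmetric]) auto
    also have "(\<Oplus>\<^bsub>T\<^esub>i\<in>{1..n}. ?R i) = (if g \<in> H then e \<otimes>\<^bsub>T\<^esub> \<one>\<^bsub>T\<^esub> else \<zero>\<^bsub>T\<^esub>)"
      by (rule galois_sum_tr[OF xy gal g T.one_closed])
    finally show ?thesis
      using c by simp
  qed
  then show thesis
    using that[of ?x ?y] P xy c by simp
qed

end


section \<open>The induced partial Galois extension\<close>

theorem theorem3p1:
  fixes k :: "('k, 'x) ring_scheme"
    and G :: "('g, 'z) monoid_scheme"
    and S :: "('k, 'a, 'y) module_scheme"
    and D :: "'g \<Rightarrow> 'a set" and \<alpha> :: "'g \<Rightarrow> 'a \<Rightarrow> 'a" and u :: "'g \<Rightarrow> 'a"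
    and T :: "('k, 'b, 'w) module_scheme"
    and \<beta> :: "'g \<Rightarrow> 'b \<Rightarrow> 'b" and \<iota> :: "'a \<Rightarrow> 'b"
    and H :: "'g set" and h :: "nat \<Rightarrow> 'g" and m :: nat
  defines "S_G \<equiv> invariant_algebra G S \<alpha> u"
    and "S_H \<equiv> invariant_algebra (G\<lparr>carrier := H\<rparr>) S \<alpha> u"
    and "\<psi>\<^sub>H \<equiv> psi S T \<beta> \<iota> h m"
    and "u' \<equiv> induced_unit S T \<beta> \<iota> h m"
    and "\<alpha>' \<equiv> induced_map S T \<beta> \<iota> h m"
    and "D' \<equiv> induced_ideal G H S \<alpha> u T \<beta> \<iota> h m"
  assumes "finite (carrier G)"
    and "unital_partial_action k G S D \<alpha> u"
    and "partial_galois_extension k G S D \<alpha> u S_G"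
    and "normal H G"
    and "globalization k G S D \<alpha> T \<beta> \<iota>"
    and "bij_betw h {1..m} H" and "h 1 = \<one>\<^bsub>G\<^esub>"
  shows "(\<forall>g\<in>carrier G. \<iota> (u' (g <#\<^bsub>G\<^esub> H)) = \<beta> g (\<psi>\<^sub>H \<one>\<^bsub>T\<^esub>) \<otimes>\<^bsub>T\<^esub> \<iota> \<one>\<^bsub>S\<^esub>) \<and>
         (\<forall>g\<in>carrier G. \<forall>x \<in> D' (inv\<^bsub>G\<^esub> g <#\<^bsub>G\<^esub> H).
            \<iota> (\<alpha>' (g <#\<^bsub>G\<^esub> H) x) = \<beta> g (\<psi>\<^sub>H (\<iota> x)) \<otimes>\<^bsub>T\<^esub> \<iota> \<one>\<^bsub>S\<^esub>) \<and>
         unital_partial_action k (G Mod H) S_H D' \<alpha>' u' \<and>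
         partial_galois_extension k (G Mod H) S_H D' \<alpha>' u' S_G \<and>
         invariants (G Mod H) S_H \<alpha>' u' = invariants G S \<alpha> u"
proof -
  interpret quotient_restriction k G T \<beta> S D \<alpha> u \<iota> H h m
    using globalization_idempotent_restriction[OF assms(8,11)] assms(7,10,12)
    by (intro quotient_restriction.intro quotient_restriction_axioms.intro)
  interpret Q: idempotent_restriction k "G Mod H" T_H \<gamma> "invariant_algebra (G\<lparr>carrier := H\<rparr>) S \<alpha> u"
      "induced_ideal G H S \<alpha> u T \<beta> \<iota> h m" "induced_map S T \<beta> \<iota> h m" "induced_unit S T \<beta> \<iota> h m"
      "\<lambda>s. psi S T \<beta> \<iota> h m (\<iota> s)"
    by (rule quotient_idempotent_restriction)
  have unit: "\<forall>g\<in>carrier G. \<iota> (u' (g <#\<^bsub>G\<^esub> H)) = \<beta> g (\<psi>\<^sub>H \<one>\<^bsub>T\<^esub>) \<otimes>\<^bsub>T\<^esub> \<iota> \<one>\<^bsub>S\<^esub>"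
    unfolding u'_def \<psi>\<^sub>H_def using emb_induced_unit by blast
  have map: "\<forall>g\<in>carrier G. \<forall>x \<in> D' (inv\<^bsub>G\<^esub> g <#\<^bsub>G\<^esub> H).
      \<iota> (\<alpha>' (g <#\<^bsub>G\<^esub> H) x) = \<beta> g (\<psi>\<^sub>H (\<iota> x)) \<otimes>\<^bsub>T\<^esub> \<iota> \<one>\<^bsub>S\<^esub>"
    unfolding D'_def \<alpha>'_def \<psi>\<^sub>H_def
    using emb_induced_map induced_ideal_subset[OF inv_closed] by blast
  have upa: "unital_partial_action k (G Mod H) S_H D' \<alpha>' u'"
    unfolding S_H_def D'_def \<alpha>'_def u'_def by (rule Q.is_unital_partial_action)
  have inv: "invariants (G Mod H) S_H \<alpha>' u' = invariants G S \<alpha> u"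
    unfolding S_H_def D'_def \<alpha>'_def u'_def by (rule quotient_invariants)
  have "partial_galois_extension k (G Mod H) S_H D' \<alpha>' u' S_G"
    unfolding partial_galois_extension_def
  proof (intro conjI upa)
    show "finite (carrier (G Mod H))"
      unfolding quotient_carrier using assms(7) by simp
    show "algebra k S_G"
      using assms(9) by (simp add: partial_galois_extension_def)
    have "invariant_algebra (G Mod H) S_H \<alpha>' u' = S_G"
      unfolding S_G_def invariant_algebra_def inv by (simp add: S_H_def invariant_algebra_def)
    moreover have "id \<in> ring_iso S_G S_G"
      by (simp add: ring_iso_def ring_hom_def)
    ultimately show "algebras_isomorphic k S_G (invariant_algebra (G Mod H) S_H \<alpha>' u')"
      unfolding algebras_isomorphic_def by (metis id_apply)
    obtain n :: nat and x y where xy: "\<forall>i\<in>{1..n}. x i \<in> carrier S \<and> y i \<in> carrier S"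
      and gal: "\<forall>g\<in>carrier G. (\<Oplus>\<^bsub>S\<^esub>i\<in>{1..n}. x i \<otimes>\<^bsub>S\<^esub> \<alpha> g (y i \<otimes>\<^bsub>S\<^esub> u (inv\<^bsub>G\<^esub> g))) =
        (if g = \<one>\<^bsub>G\<^esub> then \<one>\<^bsub>S\<^esub> else \<zero>\<^bsub>S\<^esub>)"
      using assms(9) unfolding partial_galois_extension_def by blast
    have xy: "\<And>i. i \<in> {1..n} \<Longrightarrow> x i \<in> carrier S \<and> y i \<in> carrier S"
      using xy by blast
    have galT: "(\<Oplus>\<^bsub>T\<^esub>i\<in>{1..n}. \<iota> (x i) \<otimes>\<^bsub>T\<^esub> \<beta> g (\<iota> (y i))) =
        (if g = \<one>\<^bsub>G\<^esub> then \<iota> \<one>\<^bsub>S\<^esub> else \<zero>\<^bsub>T\<^esub>)" if g: "g \<in> carrier G" for g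
      using emb_galois_sum(2)[where I = "{1..n}" and x = x and y = y, OF _ xy g] bspec[OF gal g]
      by (cases "g = \<one>\<^bsub>G\<^esub>") simp_all
    obtain x' y' where xy': "\<And>i. i \<in> {1..n} \<Longrightarrow> x' i \<in> carrier S_H \<and> y' i \<in> carrier S_H"
      and gal': "\<And>g. g \<in> carrier G \<Longrightarrow>
        (\<Oplus>\<^bsub>T\<^esub>i\<in>{1..n}. \<psi>\<^sub>H (\<iota> (x' i)) \<otimes>\<^bsub>T\<^esub> \<beta> g (\<psi>\<^sub>H (\<iota> (y' i)))) =
        (if g \<in> H then \<psi>\<^sub>H \<one>\<^bsub>T\<^esub> else \<zero>\<^bsub>T\<^esub>)"
      using quotient_galois_coordinates[OF xy galT] unfolding S_H_def \<psi>\<^sub>H_def by blast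
    have "(\<Oplus>\<^bsub>S_H\<^esub>i\<in>{1..n}. x' i \<otimes>\<^bsub>S_H\<^esub> \<alpha>' A (y' i \<otimes>\<^bsub>S_H\<^esub> u' (inv\<^bsub>G Mod H\<^esub> A))) =
        (if A = \<one>\<^bsub>G Mod H\<^esub> then \<one>\<^bsub>S_H\<^esub> else \<zero>\<^bsub>S_H\<^esub>)" (is "?s = ?d")
      if A: "A \<in> carrier (G Mod H)" for A
    proof -
      obtain g where g: "g \<in> carrier G" "A = g <#\<^bsub>G\<^esub> H"
        using A by (rule quotient_cosetE)
      note xyH = xy'[unfolded S_H_def]
      have s: "?s \<in> carrier S_H"
        and emb: "\<psi>\<^sub>H (\<iota> ?s) = (\<Oplus>\<^bsub>T_H\<^esub>i\<in>{1..n}. \<psi>\<^sub>H (\<iota> (x' i)) \<otimes>\<^bsub>T\<^esub> \<gamma> A (\<psi>\<^sub>H (\<iota> (y' i))))"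
        using Q.emb_galois_sum[where I = "{1..n}" and x = x' and y = y', OF _ xyH A]
        unfolding S_H_def \<alpha>'_def u'_def \<psi>\<^sub>H_def by simp_all
      have fixd: "\<psi>\<^sub>H (\<iota> (x' i)) \<in> fixed" "\<psi>\<^sub>H (\<iota> (y' i)) \<in> fixed" if "i \<in> {1..n}" for i
        using xyH[OF that] unfolding \<psi>\<^sub>H_def by (auto intro: psi_fixed)
      note emb
      also have "(\<Oplus>\<^bsub>T_H\<^esub>i\<in>{1..n}. \<psi>\<^sub>H (\<iota> (x' i)) \<otimes>\<^bsub>T\<^esub> \<gamma> A (\<psi>\<^sub>H (\<iota> (y' i)))) =
          (\<Oplus>\<^bsub>T\<^esub>i\<in>{1..n}. \<psi>\<^sub>H (\<iota> (x' i)) \<otimes>\<^bsub>T\<^esub> \<gamma> A (\<psi>\<^sub>H (\<iota> (y' i))))"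
        using fixd g by (intro T.finsum_restrict_carrier fixed_subring Pi_I fixed_mult)
          (simp_all add: quotient_act)
      also have "\<dots> = (\<Oplus>\<^bsub>T\<^esub>i\<in>{1..n}. \<psi>\<^sub>H (\<iota> (x' i)) \<otimes>\<^bsub>T\<^esub> \<beta> g (\<psi>\<^sub>H (\<iota> (y' i))))"
        using fixd g by (intro T.M.finsum_cong' refl Pi_I T.m_closed) (simp_all add: quotient_act)
      also have "\<dots> = \<psi>\<^sub>H (\<iota> ?d)"
        using gal'[OF g(1)] mem_coset_iff[OF g(1)] Q.emb_zero g(2)
        unfolding \<psi>\<^sub>H_def S_H_def by simp
      finally have eq: "\<psi>\<^sub>H (\<iota> ?s) = \<psi>\<^sub>H (\<iota> ?d)" .
      have "?d \<in> carrier S_H"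
        unfolding S_H_def using Q.S.one_closed Q.S.M.zero_closed by (simp del: S_H_simps)
      then show ?thesis
        using Q.emb_eq_iff[of ?s ?d] s eq unfolding S_H_def \<psi>\<^sub>H_def by blast
    qed
    then show "\<exists>(n :: nat) x y. (\<forall>i\<in>{1..n}. x i \<in> carrier S_H \<and> y i \<in> carrier S_H) \<and>
        (\<forall>A\<in>carrier (G Mod H).
          (\<Oplus>\<^bsub>S_H\<^esub>i\<in>{1..n}. x i \<otimes>\<^bsub>S_H\<^esub> \<alpha>' A (y i \<otimes>\<^bsub>S_H\<^esub> u' (inv\<^bsub>G Mod H\<^esub> A))) =
          (if A = \<one>\<^bsub>G Mod H\<^esub> then \<one>\<^bsub>S_H\<^esub> else \<zero>\<^bsub>S_H\<^esub>))"
      using xy' by blast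
  qed
  then show ?thesis
    using unit map upa inv by blast
qed

end
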